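(* Let $Q\subset\mathbb{R}^3$ be a $3$-dimensional convex polytope containing the origin in its interior, with vertices $v_1,\ldots,v_n$, and let $M=(M_{ij})$ be the $n\times n$ matrix associated with $Q$ by the Lovász construction (recalled in the context). For $x\in\mathbb{R}^n$ let $P(x)=\{p\in\mathbb{R}^3\mid v_i^\top p\le x_i \text{ for all } i\}$. Then for all $i,j\in\{1,\ldots,n\}$ $$M_{ij}=-\left.\frac{\partial^2\mathrm{vol}_3(P(x))}{\partial x_i\,\partial x_j}\right|_{x=(1,\ldots,1)}.$$
   Context: Lovász construction. Let $Q$ be as in the claim and let $G$ be the 1-skeleton of $Q$, with vertex set $\{1,\ldots,n\}$, vertex $i$ corresponding to the vertex $v_i$ of $Q$. Let $Q^*=\{p\in\mathbb{R}^3\mid v_i^\top p\le 1 \text{ for all } i\}$ be the polar dual of $Q$ (so $Q^*=P(1,\ldots,1)$, and the facets of $Q^*$ have outer normals $v_i$). The vertices of $Q^*$ are denoted by $w_f$, where $f$ ranges over the 2-dimensional faces of $Q$. For an edge $ij$ of $G$, let $f,g$ be the two faces of $Q$ containing the edge $v_iv_j$, so that $w_fw_g$ is the edge of $Q^*$ dual to $v_iv_j$. The vector $w_f-w_g$ is parallel to $v_i\times v_j$, and $M_{ij}$ is defined by $$w_f-w_g=M_{ij}\,(v_i\times v_j),$$ where the labeling of the two faces as $f$ and $g$ is chosen so that $M_{ij}<0$. For distinct non-adjacent vertices $i,j$ of $G$ put $M_{ij}=0$. Finally, the vector $v_i'=\sum_{j:\, ij\in G}M_{ij}v_j$ (sum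 over vertices $j$ adjacent to $i$) is parallel to $v_i$, and $M_{ii}$ is the real number defined by $v_i'=-M_{ii}v_i$. *)

theory Defs
  imports "HOL-Analysis.Analysis"
begin

definition constraint_polyhedron :: "('n::finite \<Rightarrow> real^3) \<Rightarrow> real^'n \<Rightarrow> (real^3) set" where
  "constraint_polyhedron v x = {p. \<forall>i. v i \<bullet> p \<le> x $ i}"

definition polar_dual :: "('n::finite \<Rightarrow> real^3) \<Rightarrow> (real^3) set" where
  "polar_dual v = constraint_polyhedron v (\<chi> i. 1)"

definition skeleton_adj :: "(real^3) set \<Rightarrow> ('n::finite \<Rightarrow> real^3) \<Rightarrow> 'n \<Rightarrow> 'n \<Rightarrow> bool" where
  "skeleton_adj Q v i j \<longleftrightarrow> i \<noteq> j \<and> closed_segment (v i) (v j) edge_of Q"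

definition faces2 :: "(real^3) set \<Rightarrow> (real^3) set set" where
  "faces2 Q = {f. f face_of Q \<and> aff_dim f = 2}"

(* The vertex w_f of the polar dual corresponding to f under polarity:
   f is the face of Q cut out by the supporting plane y . w_f = 1. *)
definition dual_vertex :: "(real^3) set \<Rightarrow> ('n::finite \<Rightarrow> real^3) \<Rightarrow> (real^3) set \<Rightarrow> real^3" where
  "dual_vertex Q v f =
     (THE w. w extreme_point_of polar_dual v \<and> f = {y \<in> Q. y \<bullet> w = 1})"

(* Swapping f and g changes the sign of m, so m < 0 selects the labelling. *)
definition lovasz_offdiag :: "(real^3) set \<Rightarrow> ('n::finite \<Rightarrow> real^3) \<Rightarrow> 'n \<Rightarrow> 'n \<Rightarrow> real" where
  "lovasz_offdiag Q v i j =
     (if skeleton_adj Q v i j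
      then THE m. m < 0 \<and>
             (\<exists>f g. f \<noteq> g \<and>
                {F \<in> faces2 Q. closed_segment (v i) (v j) \<subseteq> F} = {f, g} \<and>
                dual_vertex Q v f - dual_vertex Q v g = m *\<^sub>R cross3 (v i) (v j))
      else 0)"

definition lovasz_diag :: "(real^3) set \<Rightarrow> ('n::finite \<Rightarrow> real^3) \<Rightarrow> 'n \<Rightarrow> real" where
  "lovasz_diag Q v i =
     (THE m. (\<Sum>j | skeleton_adj Q v i j. lovasz_offdiag Q v i j *\<^sub>R v j) = - (m *\<^sub>R v i))"

definition lovasz_matrix :: "(real^3) set \<Rightarrow> ('n::finite \<Rightarrow> real^3) \<Rightarrow> real^'n^'n" where
  "lovasz_matrix Q v =
     (\<chi> i j. if i = j then lovasz_diag Q v i else lovasz_offdiag Q v i j)"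

definition has_partial_derivative ::
    "(real^'n::finite \<Rightarrow> real) \<Rightarrow> 'n \<Rightarrow> real \<Rightarrow> real^'n \<Rightarrow> bool" where
  "has_partial_derivative F i D x \<longleftrightarrow>
     ((\<lambda>t. F (x + t *\<^sub>R axis i 1)) has_real_derivative D) (at 0)"

(* D is the iterated partial derivative d/dx_i (d F/dx_j) at x; its existence is part of
   the claim, including that of dF/dx_j on a neighbourhood of x. *)
definition has_second_partial_derivative ::
    "(real^'n::finite \<Rightarrow> real) \<Rightarrow> 'n \<Rightarrow> 'n \<Rightarrow> real \<Rightarrow> real^'n \<Rightarrow> bool" where
  "has_second_partial_derivative F i j D x \<longleftrightarrow>
     (\<exists>G. (\<forall>\<^sub>F y in nhds x. has_partial_derivative F j (G y) y) \<and>
          has_partial_derivative G i D x)"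

end

theory Submission
  imports Defs
begin

text \<open>
  Slicing the polyhedron along a constraint normal and using Fubini, the derivative of the volume in
  the direction \<open>x j\<close> is the (rescaled) area of the \<open>j\<close>-th facet, and the derivative of that area in
  the direction \<open>x i\<close> is the (rescaled) length of the intersection of the two facets. The slices
  depend continuously on \<open>x\<close>, by dominated convergence, as soon as no constraint with vanishing normal
  is tight; near \<open>x = (1, \<dots>, 1)\<close> this holds because no three vertices of \<open>Q\<close> are collinear, so the
  polar dual need not be simple. At \<open>(1, \<dots>, 1)\<close> the length is that of the dual edge \<open>w f - w g\<close>, and it
  is zero when \<open>v i\<close> and \<open>v j\<close> are not adjacent.

  For the diagonal, translating the polyhedron by \<open>q\<close> moves \<open>x\<close> along \<open>(v k \<bullet> q)\<close> over all \<open>k\<close> and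
  preserves the facet areas. Translations orthogonal to \<open>v j\<close> show that the sum defining \<open>M j j\<close> is
  parallel to \<open>v j\<close>; the translation along \<open>v j\<close> computes the missing derivative.
\<close>

section \<open>Volumes of systems of half-spaces\<close>

text \<open>Restricting to an index set \<open>K\<close> lets a slice drop a constraint while the
  index type stays fixed; the ambient space is arbitrary because slicing lowers the dimension from
  three to two to one.\<close>

definition halfspace_volume :: "'n set \<Rightarrow> ('n::finite \<Rightarrow> 'a::euclidean_space) \<Rightarrow> real^'n \<Rightarrow> real" where
  "halfspace_volume K v y = measure lborel {p. \<forall>k\<in>K. v k \<bullet> p \<le> y $ k}"

text \<open>Quantifying over every common right-hand side makes this a condition on the normals
  alone, so it serves all \<open>y\<close> at once.\<close>

definition bounded_system :: "'n set \<Rightarrow> ('n::finite \<Rightarrow> 'a::euclidean_space) \<Rightarrow> bool" where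
  "bounded_system K v \<longleftrightarrow> (\<forall>C. bounded {p. \<forall>k\<in>K. v k \<bullet> p \<le> C})"

text \<open>A constraint with zero normal is vacuous or infeasible according to the sign of its
  right-hand side; excluding 0 keeps this status, and so the volume, from jumping. Such constraints
  arise when a normal is parallel to the slicing direction.\<close>

definition nondegenerate :: "'n set \<Rightarrow> ('n::finite \<Rightarrow> 'a::euclidean_space) \<Rightarrow> real^'n \<Rightarrow> bool" where
  "nondegenerate K v y \<longleftrightarrow> (\<forall>k\<in>K. v k = 0 \<longrightarrow> y $ k \<noteq> 0)"

section \<open>Continuity of the volume in the right-hand sides\<close>

lemma closed_halfspaces: "closed {p::'a::euclidean_space. \<forall>k\<in>K. v k \<bullet> p \<le> y k}"
proof -
  have "{p. \<forall>k\<in>K. v k \<bullet> p \<le> y k} = (\<Inter>k\<in>K. {p. v k \<bullet> p \<le> y k})" by auto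
  then show ?thesis by (auto intro: closed_halfspace_le)
qed

lemma integrable_indicator_compact:
  fixes S :: "'a::euclidean_space set"
  assumes "compact S"
  shows "integrable lborel (indicat_real S)"
  using emeasure_bounded_finite[OF compact_imp_bounded[OF assms]] assms
  by (intro integrable_real_indicator) (auto simp: borel_compact)

lemma bounded_halfspaces:
  assumes "bounded_system K v"
  shows "bounded {p. \<forall>k\<in>K. v k \<bullet> p \<le> y $ k}"
proof -
  have "{p. \<forall>k\<in>K. v k \<bullet> p \<le> y $ k} \<subseteq> {p. \<forall>k\<in>K. v k \<bullet> p \<le> norm y}"
    by (smt (verit, best) Collect_mono component_le_norm_cart)
  then show ?thesis using assms bounded_subset unfolding bounded_system_def by blast
qed

lemma compact_halfspaces:
  assumes "bounded_system K v"
  shows "compact {p. \<forall>k\<in>K. v k \<bullet> p \<le> y $ k}"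
  using closed_halfspaces[of K v "\<lambda>k. y $ k"] bounded_halfspaces[OF assms]
  by (simp add: compact_eq_bounded_closed)

text \<open>Dominated convergence for the indicators along a sequence \<open>Y\<close>: off the null
  union of the bounding hyperplanes, membership of a fixed point is eventually constant.\<close>

lemma isCont_halfspace_volume:
  assumes bd: "bounded_system K v" and nd: "nondegenerate K v y"
  shows "isCont (halfspace_volume K v) y"
proof (subst continuous_at_sequentially, intro allI impI)
  fix Y assume Y: "Y \<longlonglongrightarrow> y"
  let ?P = "\<lambda>y. {p. \<forall>k\<in>K. v k \<bullet> p \<le> y $ k}"
  obtain C where C: "\<And>n. norm (Y n) \<le> C"
    using Bseq_def convergent_imp_Bseq[of Y] Y convergent_def by (metis)
  \<comment> \<open>Every component of \<open>Y n\<close> is at most \<open>norm (Y n)\<close>,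
    hence at most \<open>C\<close>; so the indicator of \<open>B\<close> dominates the whole
    sequence.\<close>
  define B where "B = {p. \<forall>k\<in>K. v k \<bullet> p \<le> C}"
  have B: "compact B"
    using bd closed_halfspaces[of K v "\<lambda>_. C"]
    by (simp add: compact_eq_bounded_closed bounded_system_def B_def)
  have sub: "?P (Y n) \<subseteq> B" for n
    using C[of n] component_le_norm_cart[of "Y n"] unfolding B_def by (smt (verit, best) Collect_mono)
  have meas: "?P z \<in> sets lborel" for z
    using closed_halfspaces[of K v "\<lambda>k. z $ k"] by simp
  have conv: "(\<lambda>n. \<integral>p. indicat_real (?P (Y n)) p \<partial>lborel) \<longlonglongrightarrow> (\<integral>p. indicat_real (?P y) p \<partial>lborel)"
  proof (rule integral_dominated_convergence[where w="indicat_real B"])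
    show "integrable lborel (indicat_real B)"
      using B by (rule integrable_indicator_compact)
    have null: "AE p in lborel. \<forall>k\<in>K. v k \<noteq> 0 \<longrightarrow> v k \<bullet> p \<noteq> y $ k"
    proof (rule AE_finite_allI)
      fix k assume "k \<in> K"
      have "AE p in lborel. v k \<bullet> p \<noteq> y $ k" if "v k \<noteq> 0"
      proof -
        have "{p. v k \<bullet> p = y $ k} \<in> null_sets lebesgue"
          using negligible_hyperplane[of "v k" "y $ k"] that by (simp add: negligible_iff_null_sets)
        moreover have "{p. v k \<bullet> p = y $ k} \<in> sets lborel"
          by (simp add: closed_hyperplane)
        ultimately have "{p. v k \<bullet> p = y $ k} \<in> null_sets lborel"
          using null_sets_completion_iff by blast
        then show ?thesis by (simp add: AE_iff_null_sets AE_not_in[THEN AE_mp])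
      qed
      then show "AE p in lborel. v k \<noteq> 0 \<longrightarrow> v k \<bullet> p \<noteq> y $ k" by auto
    qed simp
    show "AE p in lborel. (\<lambda>n. indicat_real (?P (Y n)) p) \<longlonglongrightarrow> indicat_real (?P y) p"
      using null
    proof eventually_elim
      case (elim p)
      have "\<forall>\<^sub>F n in sequentially. v k \<bullet> p \<le> Y n $ k \<longleftrightarrow> v k \<bullet> p \<le> y $ k" if "k \<in> K" for k
      proof -
        \<comment> \<open>For \<open>v k = 0\<close> this is nondegeneracy, as the inner product is
          0; otherwise \<open>p\<close> avoids the hyperplane.\<close>
        have ne: "v k \<bullet> p \<noteq> y $ k" using elim nd that unfolding nondegenerate_def by force
        have lim: "(\<lambda>n. Y n $ k) \<longlonglongrightarrow> y $ k" using Y by (rule tendsto_vec_nth)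
        show ?thesis
        proof (cases "v k \<bullet> p < y $ k")
          case True
          show ?thesis using order_tendstoD(1)[OF lim True] by eventually_elim (use True in auto)
        next
          case False
          then have "y $ k < v k \<bullet> p" using ne by simp
          from order_tendstoD(2)[OF lim this] show ?thesis by eventually_elim (use False ne in auto)
        qed
      qed
      then have "\<forall>\<^sub>F n in sequentially. \<forall>k\<in>K. v k \<bullet> p \<le> Y n $ k \<longleftrightarrow> v k \<bullet> p \<le> y $ k"
        by (simp add: eventually_ball_finite_distrib)
      then have "\<forall>\<^sub>F n in sequentially. indicat_real (?P (Y n)) p = indicat_real (?P y) p"
        by eventually_elim (auto simp: indicator_def)
      then show ?case by (rule tendsto_eventually)
    qed
    show "AE p in lborel. norm (indicat_real (?P (Y n)) p) \<le> indicat_real B p" for n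
      using sub[of n] by (auto simp: indicator_def)
  qed (use meas in auto)
  then show "(halfspace_volume K v \<circ> Y) \<longlonglongrightarrow> halfspace_volume K v y"
    using meas by (simp add: halfspace_volume_def comp_def)
qed

lemma eventually_nondegenerate:
  assumes "nondegenerate K v (h y)" and "isCont h y"
  shows "\<forall>\<^sub>F z in nhds y. nondegenerate K v (h z)"
proof -
  have lim: "(h \<longlongrightarrow> h y) (nhds y)"
    using assms(2) continuous_at tendsto_nhds_iff by blast
  have "\<forall>\<^sub>F z in nhds y. v k = 0 \<longrightarrow> h z $ k \<noteq> 0" if "k \<in> K" for k
  proof (cases "v k = 0")
    case True
    have "((\<lambda>z. h z $ k) \<longlongrightarrow> h y $ k) (nhds y)" using lim by (rule tendsto_vec_nth)
    moreover have "h y $ k \<noteq> 0" using assms(1) True that unfolding nondegenerate_def by blast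
    ultimately show ?thesis by (auto elim!: tendsto_imp_eventually_ne eventually_mono)
  qed auto
  then show ?thesis unfolding nondegenerate_def by (simp add: eventually_ball_finite_distrib)
qed

section \<open>Slicing off one constraint\<close>

lemma bounded_system_slice:
  fixes v :: "'n::finite \<Rightarrow> real \<times> 'b::euclidean_space"
  assumes bd: "bounded_system K v" and vj: "v j = (1, 0)"
  shows "bounded_system (K - {j}) (snd \<circ> v)"
  unfolding bounded_system_def
proof
  fix C
  \<comment> \<open>\<open>max 0 C\<close> because at points \<open>(0, p)\<close> constraint
    \<open>j\<close> reads \<open>0 \<le> C\<close>, which fails for negative
    \<open>C\<close>.\<close>
  have "Pair 0 ` {p. \<forall>k\<in>K - {j}. (snd \<circ> v) k \<bullet> p \<le> C} \<subseteq> {p. \<forall>k\<in>K. v k \<bullet> p \<le> max 0 C}"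
  proof clarify
    fix p k assume p: "\<forall>k\<in>K - {j}. (snd \<circ> v) k \<bullet> p \<le> C" and k: "k \<in> K"
    then show "v k \<bullet> (0, p) \<le> max 0 C"
      using vj by (cases "k = j") (auto simp: inner_prod_def intro: max.coboundedI2)
  qed
  then have "bounded (Pair 0 ` {p. \<forall>k\<in>K - {j}. (snd \<circ> v) k \<bullet> p \<le> C} :: (real \<times> 'b) set)"
    using bd bounded_subset unfolding bounded_system_def by blast
  then have "bounded (snd ` (Pair (0::real) ` {p. \<forall>k\<in>K - {j}. (snd \<circ> v) k \<bullet> p \<le> C}))"
    by (rule bounded_snd)
  then show "bounded {p. \<forall>k\<in>K - {j}. (snd \<circ> v) k \<bullet> p \<le> C}" by (simp add: image_image)
qed

text \<open>Constraint \<open>j\<close> only bounds the first coordinate by \<open>y $ j\<close>, so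
  by Fubini the volume is the integral over \<open>a \<le> y $ j\<close> of the slice volume
  \<open>f a\<close>. As \<open>f\<close> does not involve \<open>y $ j\<close>, the fundamental
  theorem of calculus applies where \<open>f\<close> is continuous.\<close>

lemma has_partial_derivative_halfspace_volume:
  fixes v :: "'n::finite \<Rightarrow> real \<times> 'b::euclidean_space"
  assumes bd: "bounded_system K v" and j: "j \<in> K" and vj: "v j = (1, 0)"
    and nd: "nondegenerate (K - {j}) (snd \<circ> v) (\<chi> k. y $ k - fst (v k) * y $ j)"
  shows "has_partial_derivative (halfspace_volume K v) j
           (halfspace_volume (K - {j}) (snd \<circ> v) (\<chi> k. y $ k - fst (v k) * y $ j)) y"
proof -
  let ?P = "\<lambda>y. {p. \<forall>k\<in>K. v k \<bullet> p \<le> y $ k}"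
  define f where "f a = halfspace_volume (K - {j}) (snd \<circ> v) (\<chi> k. y $ k - fst (v k) * a)" for a
  define Y where "Y s = y + (s - y $ j) *\<^sub>R axis j 1" for s
  define \<Phi> where "\<Phi> s = halfspace_volume K v (Y s)" for s
  have slice: "measure lborel (Pair a -` ?P (Y s)) = indicat_real {..s} a * f a" for a s
  proof (cases "a \<le> s")
    case True
    have "Pair a -` ?P (Y s)
        = {p. \<forall>k\<in>K - {j}. (snd \<circ> v) k \<bullet> p \<le> (\<chi> k. y $ k - fst (v k) * a) $ k}"
      using True vj j by (force simp: Y_def inner_prod_def axis_def algebra_simps split: if_splits)
    then show ?thesis using True by (simp add: f_def halfspace_volume_def)
  next
    case False
    have "Pair a -` ?P (Y s) = {}"
      using False vj j by (force simp: Y_def inner_prod_def)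
    then show ?thesis using False by (simp only: measure_empty) simp
  qed
  have Pint: "integrable (lborel \<Otimes>\<^sub>M lborel) (indicat_real (?P z))" for z
    unfolding lborel_prod
    using compact_halfspaces[OF bd, of z] by (rule integrable_indicator_compact)
  have Pmeas: "?P z \<in> sets (borel :: (real \<times> 'b) measure)" for z
    using closed_halfspaces[of K v "\<lambda>k. z $ k"] by simp
  have smeas: "Pair a -` ?P z \<in> sets (borel :: 'b measure)" for a z
    by (rule sets_Pair1[where ?M1.0=borel]) (use Pmeas[of z] in \<open>simp only: borel_prod\<close>)
  have inner_eq: "(\<integral>b. indicat_real (?P z) (a, b) \<partial>lborel) = measure lborel (Pair a -` ?P z)" for a z
  proof -
    have "(\<integral>b. indicat_real (?P z) (a, b) \<partial>lborel) = (\<integral>b. indicat_real (Pair a -` ?P z) b \<partial>lborel)"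
      by (rule Bochner_Integration.integral_cong) (auto simp: indicator_def)
    then show ?thesis using smeas by simp
  qed
  have int: "integrable lborel (\<lambda>a. indicat_real {..s} a * f a)" for s
    using lborel_pair.integrable_fst'[OF Pint, of "Y s"]
    by (simp only: inner_eq slice)
  have \<Phi>: "\<Phi> s = (\<integral>a. indicat_real {..s} a * f a \<partial>lborel)" for s
    using lborel_pair.integral_fst'[OF Pint, of "Y s"] Pmeas
    by (simp only: inner_eq slice lborel_prod) (simp add: \<Phi>_def halfspace_volume_def)
  \<comment> \<open>The fundamental theorem is used on a compact interval; this base point puts
    \<open>y $ j\<close> in the middle of \<open>{c..c+2}\<close>.\<close>
  define c where "c = y $ j - 1"
  have sint: "set_integrable lborel {c..s} f" for s
  proof -
    have "set_integrable lborel {..s} f" using int[of s] by (simp add: set_integrable_def)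
    then show ?thesis by (rule set_integrable_subset) auto
  qed
  have diff: "\<Phi> s = \<Phi> c + integral {c..s} f" if "c \<le> s" for s
  proof -
    have "\<Phi> s - \<Phi> c = (\<integral>a. indicat_real {..s} a * f a - indicat_real {..c} a * f a \<partial>lborel)"
      unfolding \<Phi> using int by simp
    also have "\<dots> = (\<integral>a. indicat_real {c..s} a * f a \<partial>lborel)"
    proof (rule integral_cong_AE)
      show "AE a in lborel. indicat_real {..s} a * f a - indicat_real {..c} a * f a = indicat_real {c..s} a * f a"
        using AE_lborel_singleton[of c] by eventually_elim (use that in \<open>auto simp: indicator_def\<close>)
    qed (use int sint[of s] in \<open>auto simp: set_integrable_def intro: borel_measurable_integrable\<close>)
    also have "\<dots> = integral {c..s} f"
      using set_borel_integral_eq_integral(2)[OF sint[of s]] by (simp add: set_lebesgue_integral_def)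
    finally show ?thesis by simp
  qed
  have "isCont (\<lambda>a. (\<chi> k. y $ k - fst (v k) * a) :: real^'n) (y $ j)"
    unfolding isCont_def by (intro tendsto_vec_lambda tendsto_intros)
  then have "isCont f (y $ j)"
    unfolding f_def
    by (rule isCont_o2[where g="halfspace_volume (K - {j}) (snd \<circ> v)"])
      (rule isCont_halfspace_volume[OF bounded_system_slice[where ?v=v and j=j, OF bd vj] nd])
  then have cont: "continuous (at (y $ j) within {c..c+2} - {}) f"
    by (simp add: continuous_at_imp_continuous_at_within)
  have "((\<lambda>u. integral {c..u} f) has_vector_derivative f (y $ j)) (at (y $ j) within ({c..c+2} - {}))"
    by (rule integral_has_vector_derivative_continuous_at[OF _ _ _ cont])
      (use set_borel_integral_eq_integral(1)[OF sint] in \<open>auto simp: c_def\<close>)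
  moreover have "at (y $ j) within ({c..c+2} - {}) = at (y $ j)"
    by (simp only: Diff_empty, rule at_within_Icc_at) (simp_all add: c_def)
  ultimately have "((\<lambda>u. integral {c..u} f) has_real_derivative f (y $ j)) (at (y $ j))"
    unfolding has_real_derivative_iff_has_vector_derivative by (simp only:)
  from DERIV_add[OF DERIV_const this, of "\<Phi> c"]
  have "((\<lambda>u. \<Phi> c + integral {c..u} f) has_real_derivative f (y $ j)) (at (y $ j))"
    by simp
  moreover have "\<forall>\<^sub>F u in nhds (y $ j). \<Phi> c + integral {c..u} f = \<Phi> u"
  proof -
    have "\<forall>\<^sub>F u in nhds (y $ j). u \<in> {c<..}" by (rule eventually_nhds_in_open) (auto simp: c_def)
    then show ?thesis by (rule eventually_mono) (rule diff[symmetric], simp)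
  qed
  ultimately have "(\<Phi> has_real_derivative f (y $ j)) (at (y $ j))"
    using DERIV_cong_ev[OF refl _ refl, of "\<lambda>u. \<Phi> c + integral {c..u} f" \<Phi> "y $ j" "f (y $ j)"] by simp
  then have "((\<lambda>t. \<Phi> (t + y $ j)) has_real_derivative f (y $ j)) (at 0)"
    using DERIV_shift[of \<Phi> "f (y $ j)" 0 "y $ j"] by simp
  then show ?thesis by (simp add: has_partial_derivative_def \<Phi>_def Y_def f_def)
qed

section \<open>Partial derivatives\<close>

lemma has_partial_derivative_cong:
  assumes "\<forall>\<^sub>F z in nhds y. F z = G z"
  shows "has_partial_derivative F i D y \<longleftrightarrow> has_partial_derivative G i D y"
proof -
  have "((\<lambda>t. y + t *\<^sub>R axis i (1::real)) \<longlongrightarrow> y + 0 *\<^sub>R axis i 1) (nhds 0)"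
    by (intro tendsto_intros filterlim_ident)
  then have "\<forall>\<^sub>F t in nhds 0. F (y + t *\<^sub>R axis i 1) = G (y + t *\<^sub>R axis i 1)"
    using assms by (auto simp: filterlim_iff)
  then show ?thesis unfolding has_partial_derivative_def by (rule DERIV_cong_ev[OF refl _ refl])
qed

lemma has_partial_derivative_at_shift:
  assumes "has_partial_derivative F i D (x + s *\<^sub>R axis i 1)"
  shows "((\<lambda>t. F (x + t *\<^sub>R axis i 1)) has_real_derivative D) (at s)"
proof -
  have "((\<lambda>t. F (x + (t + s) *\<^sub>R axis i 1)) has_real_derivative D) (at 0)"
    using assms by (simp add: has_partial_derivative_def algebra_simps)
  then show ?thesis using DERIV_shift[of "\<lambda>t. F (x + t *\<^sub>R axis i 1)" D 0 s] by simp
qed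

text \<open>The increment used below has either sign and may vanish, so the intermediate point is
  bounded weakly by \<open>\<bar>c\<bar>\<close>.\<close>

lemma mean_value_abs:
  fixes h :: "real \<Rightarrow> real"
  assumes "\<And>s. \<bar>s\<bar> \<le> \<bar>c\<bar> \<Longrightarrow> (h has_real_derivative h' s) (at s)"
  obtains \<xi> where "\<bar>\<xi>\<bar> \<le> \<bar>c\<bar>" and "h c - h 0 = c * h' \<xi>"
proof (cases c "0::real" rule: linorder_cases)
  case less
  then obtain z where "c < z" "z < 0" "h 0 - h c = (0 - c) * h' z"
    using MVT2[of c 0 h h'] assms by auto
  then show thesis using that[of z] less by (simp add: algebra_simps)
next
  case greater
  then obtain z where "0 < z" "z < c" "h c - h 0 = (c - 0) * h' z"
    using MVT2[of 0 c h h'] assms by auto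
  then show thesis using that[of z] greater by simp
qed (use that in auto)

text \<open>Induction over the directions: walk along those already treated, then along
  \<open>axis i 1\<close>. The mean value theorem turns the second leg into a value of
  \<open>g i\<close> at a point tending to \<open>x\<close>, so continuity of \<open>g i\<close> at
  the single point \<open>x\<close> gives the limit.\<close>

lemma has_real_derivative_directional:
  fixes F :: "real^'n::finite \<Rightarrow> real"
  assumes "finite S"
    and "\<And>i. i \<in> S \<Longrightarrow> \<forall>\<^sub>F y in nhds x. has_partial_derivative F i (g i y) y"
    and "\<And>i. i \<in> S \<Longrightarrow> isCont (g i) x"
  shows "((\<lambda>t. F (x + t *\<^sub>R (\<Sum>i\<in>S. u i *\<^sub>R axis i 1))) has_real_derivative (\<Sum>i\<in>S. u i * g i x)) (at 0)"
  using assms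
proof (induction S rule: finite_induct)
  case (insert i S)
  define U :: "real^'n" where "U = (\<Sum>i\<in>S. u i *\<^sub>R axis i 1)"
  have IH: "((\<lambda>t. F (x + t *\<^sub>R U)) has_real_derivative (\<Sum>i\<in>S. u i * g i x)) (at 0)"
    unfolding U_def using insert by auto
  define e :: "real^'n" where "e = axis i 1"
  have norm_e: "norm e = 1" by (simp add: e_def)
  obtain d where d: "d > 0" "\<And>y. dist y x < d \<Longrightarrow> has_partial_derivative F i (g i y) y"
    using insert.prems(1)[of i] by (auto simp: eventually_nhds_metric)
  \<comment> \<open>With \<open>\<bar>t\<bar> * m < d\<close> the whole second leg stays in the ball
    of radius \<open>d\<close> around \<open>x\<close>, where the partial derivative exists.\<close>
  define m where "m = norm U + \<bar>u i\<bar> + 1"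
  \<comment> \<open>The bound on \<open>\<xi>\<close> is claimed for every \<open>t\<close>, the
    equation only for small \<open>t\<close>; a choice function then tends to 0 without further
    conditions.\<close>
  have "\<exists>\<xi>. \<bar>\<xi>\<bar> \<le> \<bar>t * u i\<bar> \<and> (\<bar>t\<bar> * m < d \<longrightarrow>
      F (x + t *\<^sub>R U + (t * u i) *\<^sub>R e) - F (x + t *\<^sub>R U) = t * u i * g i (x + t *\<^sub>R U + \<xi> *\<^sub>R e))" for t
  proof (cases "\<bar>t\<bar> * m < d")
    case True
    have "((\<lambda>s. F (x + t *\<^sub>R U + s *\<^sub>R e)) has_real_derivative g i (x + t *\<^sub>R U + s *\<^sub>R e)) (at s)"
      if s: "\<bar>s\<bar> \<le> \<bar>t * u i\<bar>" for s
    proof -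
      have "norm (t *\<^sub>R U + s *\<^sub>R e) \<le> \<bar>t\<bar> * norm U + \<bar>s\<bar>"
        using norm_triangle_ineq[of "t *\<^sub>R U" "s *\<^sub>R e"] by (simp add: norm_e)
      also have "\<dots> \<le> \<bar>t\<bar> * m" using s by (simp add: m_def algebra_simps abs_mult)
      finally have "dist (x + t *\<^sub>R U + s *\<^sub>R e) x < d"
        using True by (simp add: dist_norm add.assoc)
      then show ?thesis using d(2) unfolding e_def by (intro has_partial_derivative_at_shift) auto
    qed
    then obtain \<xi> where "\<bar>\<xi>\<bar> \<le> \<bar>t * u i\<bar>"
      "F (x + t *\<^sub>R U + (t * u i) *\<^sub>R e) - F (x + t *\<^sub>R U + 0 *\<^sub>R e) = t * u i * g i (x + t *\<^sub>R U + \<xi> *\<^sub>R e)"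
      by (rule mean_value_abs)
    then show ?thesis by auto
  qed (auto intro: exI[of _ 0])
  then obtain \<xi> where \<xi>: "\<And>t. \<bar>\<xi> t\<bar> \<le> \<bar>t * u i\<bar>"
    "\<And>t. \<bar>t\<bar> * m < d \<Longrightarrow>
      F (x + t *\<^sub>R U + (t * u i) *\<^sub>R e) - F (x + t *\<^sub>R U) = t * u i * g i (x + t *\<^sub>R U + \<xi> t *\<^sub>R e)"
    by metis
  have "(\<xi> \<longlongrightarrow> 0) (at 0)"
  proof (rule tendsto_0_le[where K="1"])
    show "((\<lambda>t. t * u i) \<longlongrightarrow> 0) (at 0)" by (auto intro!: tendsto_eq_intros)
  qed (use \<xi>(1) in auto)
  then have "((\<lambda>t. x + t *\<^sub>R U + \<xi> t *\<^sub>R e) \<longlongrightarrow> x) (at 0)"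
    by (auto intro!: tendsto_eq_intros)
  then have "((\<lambda>t. u i * g i (x + t *\<^sub>R U + \<xi> t *\<^sub>R e)) \<longlongrightarrow> u i * g i x) (at 0)"
    using insert.prems(2)[of i] by (intro tendsto_mult_left isCont_tendsto_compose[of x "g i"]) auto
  moreover have "\<forall>\<^sub>F t in at 0. u i * g i (x + t *\<^sub>R U + \<xi> t *\<^sub>R e)
      = (F (x + t *\<^sub>R U + (t * u i) *\<^sub>R e) - F (x + t *\<^sub>R U)) / t"
  proof -
    have "((\<lambda>t. \<bar>t\<bar> * m) \<longlongrightarrow> 0) (at 0)" by (auto intro!: tendsto_eq_intros)
    then have "\<forall>\<^sub>F t in at 0. \<bar>t\<bar> * m < d" using d(1) by (rule order_tendstoD)
    moreover have "\<forall>\<^sub>F t::real in at 0. t \<noteq> 0" by (simp add: eventually_at_filter)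
    ultimately show ?thesis by eventually_elim (use \<xi>(2) in auto)
  qed
  ultimately have "((\<lambda>t. (F (x + t *\<^sub>R U + (t * u i) *\<^sub>R e) - F (x + t *\<^sub>R U)) / t) \<longlongrightarrow> u i * g i x) (at 0)"
    using Lim_transform_eventually by fast
  then have "((\<lambda>t. F (x + t *\<^sub>R U + (t * u i) *\<^sub>R e) - F (x + t *\<^sub>R U)) has_real_derivative u i * g i x) (at 0)"
    by (simp add: DERIV_def)
  from DERIV_add[OF this IH] show ?case
    using insert(1,2) by (simp add: U_def e_def algebra_simps scaleR_right_distrib)
qed simp

section \<open>Coordinates adapted to two vectors\<close>

lemma continuous_on_vec3:
  "continuous_on UNIV (\<lambda>(a, b, c). vector [a, b, c] :: real^3)"
proof -
  have "(\<lambda>(a, b, c). vector [a, b, c] :: real^3)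
      = (\<lambda>p. fst p *\<^sub>R axis 1 1 + fst (snd p) *\<^sub>R axis 2 1 + snd (snd p) *\<^sub>R axis 3 1)"
    by (auto simp: fun_eq_iff vec_eq_iff forall_3 axis_def)
  then show ?thesis by (simp only:) (intro continuous_intros)
qed

text \<open>Nested pairs are the coordinates that slicing peels off one by one; agreement on boxes
  shows that the passage to them preserves Lebesgue measure.\<close>

lemma distr_vec3_lborel:
  "distr lborel borel (\<lambda>(a, b, c). vector [a, b, c]) = (lborel :: (real^3) measure)"
proof (rule lborel_eqI[symmetric])
  let ?\<phi> = "\<lambda>(a, b, c). vector [a, b, c] :: real^3"
  have meas: "?\<phi> \<in> borel_measurable borel"
    using continuous_on_vec3 by (rule borel_measurable_continuous_onI)
  fix l u :: "real^3" assume le: "\<And>b. b \<in> Basis \<Longrightarrow> l \<bullet> b \<le> u \<bullet> b"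
  have le': "l $ i \<le> u $ i" for i
    using le[of "axis i 1"] by (simp add: inner_axis)
  have "?\<phi> -` box l u = {l$1<..<u$1} \<times> {l$2<..<u$2} \<times> {l$3<..<u$3}"
    by (auto simp: mem_box_cart forall_3)
  then have "emeasure (distr lborel borel ?\<phi>) (box l u)
      = emeasure lborel ({l$1<..<u$1} \<times> {l$2<..<u$2} \<times> {l$3<..<u$3})"
    using meas by (subst emeasure_distr) auto
  also have "{l$1<..<u$1} \<times> {l$2<..<u$2} \<times> {l$3<..<u$3} = box (l$1, l$2, l$3) (u$1, u$2, u$3)"
    by (auto simp: box_prod)
  also have "emeasure lborel \<dots> = ennreal (\<Prod>b\<in>Basis. ((u$1, u$2, u$3) - (l$1, l$2, l$3)) \<bullet> b)"
    using le' by (subst emeasure_lborel_box) (auto simp: Basis_prod_def)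
  also have "(\<Prod>b\<in>Basis. ((u$1, u$2, u$3) - (l$1, l$2, l$3)) \<bullet> b) = (u$1 - l$1) * ((u$2 - l$2) * (u$3 - l$3))"
  proof -
    have "(Basis :: (real \<times> real \<times> real) set) = {(1, 0, 0), (0, 1, 0), (0, 0, 1)}"
      by (auto simp: Basis_prod_def zero_prod_def)
    then show ?thesis by (rule ssubst) (simp add: inner_prod_def)
  qed
  also have "(u$1 - l$1) * ((u$2 - l$2) * (u$3 - l$3)) = (\<Prod>b\<in>Basis. (u - l) \<bullet> b)"
  proof -
    have B: "(Basis :: (real^3) set) = (\<lambda>i. axis i 1) ` UNIV" by (auto simp: Basis_vec_def)
    have "(\<Prod>b\<in>Basis. (u - l) \<bullet> b) = (\<Prod>i\<in>UNIV. (u - l) \<bullet> axis i 1)"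
      unfolding B by (subst prod.reindex) (auto simp: inj_on_def axis_eq_axis)
    then show ?thesis unfolding UNIV_3 by (simp add: inner_axis)
  qed
  finally show "emeasure (distr lborel borel ?\<phi>) (box l u) = ennreal (\<Prod>b\<in>Basis. (u - l) \<bullet> b)" .
qed simp

text \<open>The coefficients of \<open>w\<close> in the basis \<open>a\<close>, \<open>b\<close>, \<open>n = a \<times> b\<close> are its inner products with the
  dual basis \<open>b \<times> n\<close>, \<open>n \<times> a\<close>, \<open>n\<close> (up to the factor \<open>n \<bullet> n\<close>); they are \<open>0\<close> if \<open>n = 0\<close>.\<close>

definition frame_coord :: "real^3 \<Rightarrow> real^3 \<Rightarrow> real^3 \<Rightarrow> real \<times> real \<times> real" where
  "frame_coord a b w =
     (let n = cross3 a b in (w \<bullet> cross3 b n / (n \<bullet> n), w \<bullet> cross3 n a / (n \<bullet> n), w \<bullet> n / (n \<bullet> n)))"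

text \<open>The transpose of \<open>frame_coord a b\<close>; for
  \<open>cross3 a b \<noteq> 0\<close> it is the inverse of \<open>p \<mapsto> (a \<bullet> p, b
  \<bullet> p, cross3 a b \<bullet> p)\<close>.\<close>

definition frame_point :: "real^3 \<Rightarrow> real^3 \<Rightarrow> real \<times> real \<times> real \<Rightarrow> real^3" where
  "frame_point a b = (\<lambda>(s, t, r). let n = cross3 a b in
     (s / (n \<bullet> n)) *\<^sub>R cross3 b n + (t / (n \<bullet> n)) *\<^sub>R cross3 n a + (r / (n \<bullet> n)) *\<^sub>R n)"

lemma frame_coord_inner: "frame_coord a b w \<bullet> q = w \<bullet> frame_point a b q"
  by (cases q) (auto simp: frame_coord_def frame_point_def Let_def inner_prod_def inner_add_right mult.commute)

lemma frame_point_expand: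
  assumes "cross3 a b \<noteq> 0"
  shows "frame_point a b (a \<bullet> p, b \<bullet> p, cross3 a b \<bullet> p) = p"
proof -
  let ?n = "cross3 a b"
  \<comment> \<open>Expansion of \<open>p\<close> in the reciprocal basis with denominators cleared:
    a polynomial identity in the components.\<close>
  have "(a \<bullet> p) *\<^sub>R cross3 b ?n + (b \<bullet> p) *\<^sub>R cross3 ?n a + (?n \<bullet> p) *\<^sub>R ?n = (?n \<bullet> ?n) *\<^sub>R p"
    unfolding vec_eq_iff forall_3 vector_add_component vector_scaleR_component cross_components
      inner_vec_def sum_3 inner_real_def real_scaleR_def
    by (intro conjI; algebra)
  then have "(1 / (?n \<bullet> ?n)) *\<^sub>R ((a \<bullet> p) *\<^sub>R cross3 b ?n + (b \<bullet> p) *\<^sub>R cross3 ?n a + (?n \<bullet> p) *\<^sub>R ?n) = p"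
    using assms by simp
  then show ?thesis
    by (simp add: frame_point_def Let_def scaleR_add_right)
qed

lemma inner_frame_point:
  assumes "cross3 a b \<noteq> 0"
  shows "a \<bullet> frame_point a b (s, t, r) = s" and "b \<bullet> frame_point a b (s, t, r) = t"
    and "cross3 a b \<bullet> frame_point a b (s, t, r) = r"
proof -
  let ?n = "cross3 a b"
  have nz: "?n \<bullet> ?n \<noteq> 0" using assms by simp
  have "a \<bullet> cross3 b ?n = ?n \<bullet> ?n" "b \<bullet> cross3 ?n a = ?n \<bullet> ?n"
    by (metis cross_triple inner_commute)+
  then show "a \<bullet> frame_point a b (s, t, r) = s" "b \<bullet> frame_point a b (s, t, r) = t"
    "?n \<bullet> frame_point a b (s, t, r) = r"
    using nz by (simp_all add: frame_point_def Let_def inner_add_right dot_cross_self)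
qed

text \<open>The shape that slicing asks for: \<open>a\<close> is the unit vector of the first
  coordinate, and \<open>b\<close> becomes that of the next one once the first is removed.\<close>

lemma frame_coord_self:
  assumes "cross3 a b \<noteq> 0"
  shows "frame_coord a b a = (1, 0, 0)" and "frame_coord a b b = (0, 1, 0)"
proof -
  have "frame_coord a b a \<bullet> (s, t, r) = (1, 0, 0) \<bullet> (s, t, r)"
    "frame_coord a b b \<bullet> (s, t, r) = (0, 1, 0) \<bullet> (s, t, r)" for s t r
    unfolding frame_coord_inner inner_frame_point[OF assms] by (simp_all add: inner_prod_def)
  then have "\<forall>q. frame_coord a b a \<bullet> q = (1, 0, 0) \<bullet> q" "\<forall>q. frame_coord a b b \<bullet> q = (0, 1, 0) \<bullet> q"
    by auto
  then show "frame_coord a b a = (1, 0, 0)" "frame_coord a b b = (0, 1, 0)"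
    by (simp_all only: vector_eq_rdot)
qed

lemma frame_coord_expand:
  assumes "cross3 a b \<noteq> 0" and "frame_coord a b w = (\<alpha>, \<beta>, \<gamma>)"
  shows "w = \<alpha> *\<^sub>R a + \<beta> *\<^sub>R b + \<gamma> *\<^sub>R cross3 a b"
proof -
  have "w \<bullet> p = (\<alpha> *\<^sub>R a + \<beta> *\<^sub>R b + \<gamma> *\<^sub>R cross3 a b) \<bullet> p" for p
    using frame_coord_inner[of a b w "(a \<bullet> p, b \<bullet> p, cross3 a b \<bullet> p)"]
    by (simp add: frame_point_expand[OF assms(1)] assms(2) inner_prod_def inner_add_left)
  then show ?thesis using vector_eq_rdot[of w] by blast
qed

lemma bounded_system_frame:
  fixes v :: "'n::finite \<Rightarrow> real^3"
  assumes "bounded_system UNIV v" and "cross3 a b \<noteq> 0"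
  shows "bounded_system UNIV (\<lambda>k. frame_coord a b (v k))"
  unfolding bounded_system_def
proof
  fix C
  let ?f = "\<lambda>p. (a \<bullet> p, b \<bullet> p, cross3 a b \<bullet> p)"
  have "bounded_linear ?f"
    by (intro bounded_linear_Pair bounded_linear_inner_right)
  then have "bounded (?f ` {p. \<forall>k\<in>UNIV. v k \<bullet> p \<le> C})"
    using assms(1) by (auto simp: bounded_system_def intro: bounded_linear_image)
  moreover have "{q. \<forall>k\<in>UNIV. frame_coord a b (v k) \<bullet> q \<le> C} \<subseteq> ?f ` {p. \<forall>k\<in>UNIV. v k \<bullet> p \<le> C}"
  proof
    fix q assume q: "q \<in> {q. \<forall>k\<in>UNIV. frame_coord a b (v k) \<bullet> q \<le> C}"
    then have "?f (frame_point a b q) = q" by (cases q) (simp add: inner_frame_point[OF assms(2)])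
    then show "q \<in> ?f ` {p. \<forall>k\<in>UNIV. v k \<bullet> p \<le> C}"
      using q by (intro image_eqI[of _ _ "frame_point a b q"]) (auto simp: frame_coord_inner)
  qed
  ultimately show "bounded {q. \<forall>k\<in>UNIV. frame_coord a b (v k) \<bullet> q \<le> C}" using bounded_subset by blast
qed

text \<open>The matrix \<open>T\<close> with rows \<open>a\<close>, \<open>b\<close> and
  \<open>n = cross3 a b\<close> sends \<open>p\<close> to its new coordinates, and its determinant
  is \<open>n \<bullet> n\<close>, the factor to divide by.\<close>

lemma measure_constraint_polyhedron_frame:
  fixes v :: "'n::finite \<Rightarrow> real^3"
  assumes bd: "bounded_system UNIV v" and n: "cross3 a b \<noteq> 0"
  shows "measure lebesgue (constraint_polyhedron v y)
    = halfspace_volume UNIV (\<lambda>k. frame_coord a b (v k)) y / (cross3 a b \<bullet> cross3 a b)"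
proof -
  let ?n = "cross3 a b"
  let ?\<phi> = "\<lambda>(a, b, c). vector [a, b, c] :: real^3"
  define T :: "real^3^3" where "T = vector [a, b, ?n]"
  have T: "T *v p = ?\<phi> (a \<bullet> p, b \<bullet> p, ?n \<bullet> p)" for p
    by (simp add: T_def vec_eq_iff forall_3 matrix_vector_mult_def inner_vec_def)
  have "det T = ?n \<bullet> ?n"
    unfolding T_def dot_cross_det[symmetric]
    by (metis cross_triple inner_commute)
  let ?P = "constraint_polyhedron v y"
  have P_eq: "?P = {p. \<forall>k\<in>UNIV. v k \<bullet> p \<le> y $ k}" by (auto simp: constraint_polyhedron_def)
  have "compact ?P" unfolding P_eq using bd by (rule compact_halfspaces)
  then have P: "?P \<in> lmeasurable" by (rule lmeasurable_compact)
  have cont: "continuous_on UNIV ((*v) T)" by (rule matrix_vector_mult_linear_continuous_on)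
  have TP: "compact ((*v) T ` ?P)"
    using \<open>compact ?P\<close> cont by (meson compact_continuous_image continuous_on_subset subset_UNIV)
  have vim: "?\<phi> -` ((*v) T ` ?P) = {q. \<forall>k\<in>UNIV. frame_coord a b (v k) \<bullet> q \<le> y $ k}" (is "?A = ?B")
  proof (intro set_eqI)
    fix q :: "real \<times> real \<times> real"
    obtain s t r where q: "q = (s, t, r)" by (cases q)
    have "?\<phi> q = T *v frame_point a b q"
      by (simp add: T q inner_frame_point[OF n])
    moreover have "frame_point a b q = p" if "?\<phi> q = T *v p" for p
    proof -
      have "q = (a \<bullet> p, b \<bullet> p, ?n \<bullet> p)"
        using that unfolding T q by (auto simp: vec_eq_iff forall_3)
      then show ?thesis by (simp add: frame_point_expand[OF n])
    qed
    ultimately have "?\<phi> q \<in> (*v) T ` ?P \<longleftrightarrow> frame_point a b q \<in> ?P" by blast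
    then show "q \<in> ?A \<longleftrightarrow> q \<in> ?B"
      by (simp add: frame_coord_inner constraint_polyhedron_def)
  qed
  have meas: "?\<phi> \<in> borel_measurable lborel"
    using borel_measurable_continuous_onI[OF continuous_on_vec3] by simp
  have "measure lebesgue ((*v) T ` ?P) = \<bar>det T\<bar> * measure lebesgue ?P"
    using measure_linear_image[OF matrix_vector_mul_linear P, of T] by simp
  also have "measure lebesgue ((*v) T ` ?P) = measure lborel ((*v) T ` ?P)"
    using TP by (simp add: borel_compact)
  also have "\<dots> = measure (distr lborel borel ?\<phi>) ((*v) T ` ?P)" by (simp add: distr_vec3_lborel)
  also have "\<dots> = measure lborel (?\<phi> -` ((*v) T ` ?P))"
    using TP meas by (subst measure_distr) (auto simp: borel_compact)
  also have "\<dots> = halfspace_volume UNIV (\<lambda>k. frame_coord a b (v k)) y"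
    unfolding vim halfspace_volume_def ..
  finally show ?thesis using n by (simp add: \<open>det T = ?n \<bullet> ?n\<close> field_simps)
qed

lemma measure_constraint_polyhedron_translate:
  fixes v :: "'n::finite \<Rightarrow> real^3"
  shows "measure lebesgue (constraint_polyhedron v (y + (\<chi> k. v k \<bullet> q))) = measure lebesgue (constraint_polyhedron v y)"
proof -
  have "constraint_polyhedron v (y + (\<chi> k. v k \<bullet> q)) = (+) q ` constraint_polyhedron v y"
  proof safe
    fix p assume "p \<in> constraint_polyhedron v (y + (\<chi> k. v k \<bullet> q))"
    then have "p - q \<in> constraint_polyhedron v y"
      by (simp add: constraint_polyhedron_def inner_diff_right algebra_simps)
    then show "p \<in> (+) q ` constraint_polyhedron v y" by (intro image_eqI[of _ _ "p - q"]) auto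
  qed (simp add: constraint_polyhedron_def inner_add_right add.commute)
  then show ?thesis by (simp add: measure_translation)
qed

lemma has_partial_derivative_divide:
  assumes "has_partial_derivative F i D y"
  shows "has_partial_derivative (\<lambda>y. F y / c) i (D / c) y"
  using assms unfolding has_partial_derivative_def by (rule DERIV_cdivide)

text \<open>Slicing along \<open>j\<close> shears the right-hand sides by multiples of
  \<open>y $ j\<close>; directions \<open>i \<noteq> j\<close> pass through the shear
  unchanged.\<close>

lemma has_partial_derivative_shear:
  fixes y :: "real^'n::finite"
  assumes "has_partial_derivative F i D (\<chi> k. y $ k - \<alpha> k * y $ j)" and "i \<noteq> j"
  shows "has_partial_derivative (\<lambda>y. F (\<chi> k. y $ k - \<alpha> k * y $ j)) i D y"
proof -
  have "(\<chi> k. (y + t *\<^sub>R axis i 1) $ k - \<alpha> k * (y + t *\<^sub>R axis i 1) $ j)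
      = (\<chi> k. y $ k - \<alpha> k * y $ j) + t *\<^sub>R axis i 1" for t
    using assms(2) by (simp add: vec_eq_iff axis_def)
  then show ?thesis using assms(1) by (simp only: has_partial_derivative_def)
qed

lemma isCont_shear: "isCont (\<lambda>y::real^'n::finite. (\<chi> k. y $ k - \<alpha> k * y $ j) :: real^'n) x"
  unfolding isCont_def by (intro tendsto_vec_lambda tendsto_intros)

text \<open>Both remaining coordinates are triple products containing \<open>a\<close> and
  \<open>w\<close>. A normal parallel to \<open>a\<close> thus vanishes in slices along
  \<open>a\<close>.\<close>

lemma snd_frame_coord_eq_0:
  assumes "cross3 a w = 0"
  shows "snd (frame_coord a b w) = 0"
proof -
  have "w \<bullet> cross3 (cross3 a b) a = 0"
    using cross_triple[of "cross3 a b" a w] assms by (simp add: inner_commute)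
  moreover have "w \<bullet> cross3 a b = 0"
    using cross_triple[of w a b] cross_skew[of w a] assms by (simp add: inner_commute cross_triple[of a b w])
  ultimately show ?thesis by (simp add: frame_coord_def Let_def zero_prod_def)
qed

section \<open>Derivatives of the volume of the polar dual\<close>

locale vertex_polytope =
  fixes Q :: "(real^3) set" and v :: "'n::finite \<Rightarrow> real^3"
  assumes polytope: "polytope Q"
    and aff_dim: "aff_dim Q = 3"
    and zero_interior: "0 \<in> interior Q"
    and vertices: "bij_betw v UNIV {x. x extreme_point_of Q}"
begin

section \<open>Vertices of the polytope\<close>

lemma extreme_vertex: "v k extreme_point_of Q"
  using vertices by (auto simp: bij_betw_def)

lemma inj_vertices: "inj v"
  using vertices by (auto simp: bij_betw_def)

lemma vertex_in: "v k \<in> Q"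
  using extreme_vertex extreme_point_of_def by blast

lemma vertex_nonzero: "v k \<noteq> 0"
  using extreme_point_not_in_interior[OF extreme_vertex] zero_interior by metis

lemma hull_vertices: "Q = convex hull (range v)"
  using Krein_Milman_Minkowski[of Q] polytope vertices
  by (simp add: bij_betw_def polytope_imp_compact polytope_imp_convex)

lemma inner_le:
  assumes "y \<in> Q" and "\<And>k. v k \<bullet> p \<le> C"
  shows "y \<bullet> p \<le> C"
proof -
  have "convex hull (range v) \<subseteq> {y. p \<bullet> y \<le> C}"
  proof (rule hull_minimal)
    show "range v \<subseteq> {y. p \<bullet> y \<le> C}" using assms(2) by (auto simp: inner_commute[of p])
  qed (rule convex_halfspace_le)
  then show ?thesis using assms(1) hull_vertices by (auto simp: inner_commute)
qed

text \<open>A ball of radius \<open>e\<close> around 0 lies in \<open>Q\<close>; testing its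
  boundary point in the direction of \<open>p\<close> gives
  \<open>e * norm p \<le> C\<close>.\<close>

lemma bounded_system_vertices: "bounded_system UNIV v"
  unfolding bounded_system_def
proof
  fix C
  obtain e where e: "e > 0" "cball 0 e \<subseteq> Q"
    using zero_interior mem_interior_cball by blast
  have "norm p \<le> C / e" if p: "\<forall>k\<in>UNIV. v k \<bullet> p \<le> C" for p
  proof (cases "p = 0")
    case True
    then show ?thesis using p e by (simp add: zero_le_divide_iff)
  next
    case False
    have "(e / norm p) *\<^sub>R p \<in> Q" using e False by (intro subsetD[OF e(2)]) simp
    then have "((e / norm p) *\<^sub>R p) \<bullet> p \<le> C" by (rule inner_le) (use p in auto)
    moreover have "((e / norm p) *\<^sub>R p) \<bullet> p = e * norm p"
      using False by (simp add: dot_square_norm power2_eq_square)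
    ultimately show ?thesis using e by (simp add: pos_le_divide_eq mult.commute)
  qed
  then show "bounded {p. \<forall>k\<in>UNIV. v k \<bullet> p \<le> C}" unfolding bounded_iff by blast
qed

text \<open>Otherwise all vertices are multiples of \<open>v j\<close>, and a whole line orthogonal
  to them lies in a bounded set.\<close>

lemma exists_independent_vertex: "\<exists>i. cross3 (v j) (v i) \<noteq> 0"
proof (rule ccontr)
  assume "\<nexists>i. cross3 (v j) (v i) \<noteq> 0"
  then have par: "cross3 (v j) (v k) = 0" for k by auto
  obtain w where w: "cross3 (v j) w \<noteq> 0" using cross_basis_nonzero[OF vertex_nonzero] by blast
  have orth: "v k \<bullet> cross3 (v j) w = 0" for k
    using cross_triple[of "v j" w "v k"] cross_triple[of w "v k" "v j"] cross_skew[of "v k" "v j"] par[of k]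
    by (simp add: inner_commute)
  obtain B where B: "\<And>p. (\<forall>k\<in>UNIV. v k \<bullet> p \<le> 0) \<Longrightarrow> norm p \<le> B"
    using bounded_system_vertices unfolding bounded_system_def bounded_iff by blast
  define s where "s = (\<bar>B\<bar> + 1) / norm (cross3 (v j) w)"
  have "norm (s *\<^sub>R cross3 (v j) w) \<le> B" by (rule B) (simp add: orth)
  then show False using w by (simp add: s_def)
qed

text \<open>Of three distinct collinear points one lies strictly between the other two, which a
  vertex cannot do; which one it is depends on where \<open>\<beta>\<close> lies relative to 0 and
  1.\<close>

lemma not_collinear_vertices:
  assumes "v k = \<alpha> *\<^sub>R v j + \<beta> *\<^sub>R v i" and "\<alpha> + \<beta> = 1" and "i \<noteq> j"
  shows "k = i \<or> k = j"
proof (rule ccontr)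
  assume k: "\<not> (k = i \<or> k = j)"
  have ne: "v k \<noteq> v i" "v k \<noteq> v j" "v i \<noteq> v j"
    using k assms(3) inj_vertices by (auto dest: injD)
  have ext: "\<not> (v m \<in> open_segment (v a) (v b))" for m a b
    using extreme_vertex[of m] vertex_in unfolding extreme_point_of_def by blast
  have \<alpha>: "\<alpha> = 1 - \<beta>" using assms(2) by simp
  consider "\<beta> < 0" | "\<beta> = 0" | "0 < \<beta>" "\<beta> < 1" | "\<beta> = 1" | "\<beta> > 1" by linarith
  then show False
  proof cases
    case 1
    have "v j = (1 - (-\<beta>) / (1 - \<beta>)) *\<^sub>R v k + ((-\<beta>) / (1 - \<beta>)) *\<^sub>R v i"
    proof -
      have "(1 - \<beta>) *\<^sub>R v j = v k - \<beta> *\<^sub>R v i" using assms(1) \<alpha> by simp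
      then have "v j = (1 / (1 - \<beta>)) *\<^sub>R (v k - \<beta> *\<^sub>R v i)"
        using 1
        by (metis (no_types) divide_self_if less_irrefl scaleR_one scaleR_scaleR times_divide_eq_left mult_1 diff_gt_0_iff_gt less_trans zero_less_one)
      moreover have "1 - (-\<beta>) / (1 - \<beta>) = 1 / (1 - \<beta>)" using 1 by (simp add: field_simps)
      ultimately show ?thesis by (simp add: scaleR_diff_right)
    qed
    then have "v j \<in> open_segment (v k) (v i)"
      using 1 ne unfolding in_segment by (intro conjI exI[of _ "(-\<beta>) / (1 - \<beta>)"]) (auto simp: field_simps)
    then show False using ext by blast
  next
    case 3
    then have "v k \<in> open_segment (v j) (v i)"
      using assms(1) \<alpha> ne unfolding in_segment by metis
    then show False using ext by blast
  next
    case 5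
    have "v i = (1 - (1 - 1 / \<beta>)) *\<^sub>R v k + (1 - 1 / \<beta>) *\<^sub>R v j"
    proof -
      have "\<beta> *\<^sub>R v i = v k + (\<beta> - 1) *\<^sub>R v j" using assms(1) \<alpha> by (simp add: algebra_simps)
      then have "v i = (1 / \<beta>) *\<^sub>R (v k + (\<beta> - 1) *\<^sub>R v j)"
        using 5
        by (metis divide_self_if less_irrefl scaleR_one scaleR_scaleR times_divide_eq_left mult_1 less_trans zero_less_one)
      moreover have "(\<beta> - 1) / \<beta> = 1 - 1 / \<beta>" using 5 by (simp add: field_simps)
      ultimately show ?thesis by (simp add: scaleR_add_right)
    qed
    then have "v i \<in> open_segment (v k) (v j)"
      using 5 ne unfolding in_segment by (intro conjI exI[of _ "1 - 1 / \<beta>"]) (auto simp: field_simps)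
    then show False using ext by blast
  qed (use assms(1) \<alpha> ne in auto)
qed

section \<open>Facet areas and edge lengths as slices\<close>

abbreviation one :: "real^'n" where "one \<equiv> \<chi> k. 1"

definition vol :: "real^'n \<Rightarrow> real" where
  "vol y = measure lebesgue (constraint_polyhedron v y)"

text \<open>Defined as a derivative and not as a slice: this needs no companion vertex, and it
  inherits the translation invariance of \<open>vol\<close>.\<close>

definition facet_area :: "'n \<Rightarrow> real^'n \<Rightarrow> real" where
  "facet_area j y = deriv (\<lambda>t. vol (y + t *\<^sub>R axis j 1)) 0"

text \<open>An explicit form of \<open>facet_area j\<close> near \<open>one\<close>. The companion
  \<open>i\<close> supplies the second coordinate, so that constraint \<open>i\<close> can be sliced
  next.\<close>

definition facet_slice :: "'n \<Rightarrow> 'n \<Rightarrow> real^'n \<Rightarrow> real" where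
  "facet_slice j i y =
    (let w = \<lambda>k. frame_coord (v j) (v i) (v k); n = cross3 (v j) (v i)
     in halfspace_volume (UNIV - {j}) (snd \<circ> w) (\<chi> k. y $ k - fst (w k) * y $ j) / (n \<bullet> n))"

definition edge_slice :: "'n \<Rightarrow> 'n \<Rightarrow> real^'n \<Rightarrow> real" where
  "edge_slice j i y =
    (let w = \<lambda>k. frame_coord (v j) (v i) (v k); n = cross3 (v j) (v i);
         z = \<chi> k. y $ k - fst (w k) * y $ j
     in halfspace_volume (UNIV - {j} - {i}) (snd \<circ> (snd \<circ> w)) (\<chi> k. z $ k - fst ((snd \<circ> w) k) * z $ i) / (n \<bullet> n))"

text \<open>A violation would have coordinates \<open>(1, 0, 0)\<close>, forcing
  \<open>v k = v j\<close>.\<close>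

lemma nondegenerate_facet:
  assumes "cross3 (v j) (v i) \<noteq> 0"
  shows "nondegenerate (UNIV - {j}) (snd \<circ> (\<lambda>k. frame_coord (v j) (v i) (v k)))
           (\<chi> k. one $ k - fst (frame_coord (v j) (v i) (v k)) * one $ j)"
  unfolding nondegenerate_def
proof (intro ballI impI notI)
  fix k assume k: "k \<in> UNIV - {j}" and "(snd \<circ> (\<lambda>k. frame_coord (v j) (v i) (v k))) k = 0"
    and "(\<chi> k. one $ k - fst (frame_coord (v j) (v i) (v k)) * one $ j) $ k = 0"
  then have "frame_coord (v j) (v i) (v k) = (1, 0, 0)" by (simp add: prod_eq_iff)
  then have "v k = v j" using frame_coord_expand[OF assms] by fastforce
  then show False using k inj_vertices by (auto dest: injD)
qed

text \<open>A violation would make \<open>v k\<close> an affine combination of \<open>v j\<close>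
  and \<open>v i\<close>, hence a third vertex on their line.\<close>

lemma nondegenerate_edge:
  assumes n: "cross3 (v j) (v i) \<noteq> 0"
  defines "w \<equiv> \<lambda>k. frame_coord (v j) (v i) (v k)"
  defines "z \<equiv> \<chi> k. one $ k - fst (w k) * one $ j"
  shows "nondegenerate (UNIV - {j} - {i}) (snd \<circ> (snd \<circ> w)) (\<chi> k. z $ k - fst ((snd \<circ> w) k) * z $ i)"
  unfolding nondegenerate_def
proof (intro ballI impI notI)
  fix k assume k: "k \<in> UNIV - {j} - {i}" and "(snd \<circ> (snd \<circ> w)) k = 0"
    and "(\<chi> k. z $ k - fst ((snd \<circ> w) k) * z $ i) $ k = 0"
  \<comment> \<open>This gives \<open>z $ i = 1\<close>, so the vanishing right-hand side says that
    the coefficients of \<open>v j\<close> and \<open>v i\<close> sum to 1.\<close>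
  moreover have "w i = (0, 1, 0)" unfolding w_def by (rule frame_coord_self(2)[OF n])
  ultimately have "w k = (fst (w k), fst (snd (w k)), 0)" and sum: "fst (w k) + fst (snd (w k)) = 1"
    by (simp_all add: z_def prod_eq_iff)
  then have "v k = fst (w k) *\<^sub>R v j + fst (snd (w k)) *\<^sub>R v i"
    using frame_coord_expand[OF n, of "v k"] unfolding w_def by fastforce
  moreover have "i \<noteq> j" using n by auto
  ultimately show False using not_collinear_vertices sum k by blast
qed

lemma partial_vol_slice:
  assumes n: "cross3 (v j) (v i) \<noteq> 0"
  shows "\<forall>\<^sub>F y in nhds one. has_partial_derivative vol j (facet_slice j i y) y"
proof -
  let ?w = "\<lambda>k. frame_coord (v j) (v i) (v k)"
  have vol: "vol = (\<lambda>y. halfspace_volume UNIV ?w y / (cross3 (v j) (v i) \<bullet> cross3 (v j) (v i)))"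
    unfolding vol_def using measure_constraint_polyhedron_frame[OF bounded_system_vertices n] by auto
  have "\<forall>\<^sub>F y in nhds one. nondegenerate (UNIV - {j}) (snd \<circ> ?w) (\<chi> k. y $ k - fst (?w k) * y $ j)"
    by (rule eventually_nondegenerate[OF nondegenerate_facet[OF n] isCont_shear])
  then show ?thesis
  proof eventually_elim
    case (elim y)
    show ?case
      unfolding vol facet_slice_def Let_def
      by (intro has_partial_derivative_divide has_partial_derivative_halfspace_volume elim
            bounded_system_frame bounded_system_vertices n frame_coord_self(1)[folded zero_prod_def]) simp
  qed
qed

lemma eventually_facet_area_eq:
  assumes "cross3 (v j) (v i) \<noteq> 0"
  shows "\<forall>\<^sub>F y in nhds one. facet_area j y = facet_slice j i y"
  using partial_vol_slice[OF assms]
  by eventually_elim (auto simp: facet_area_def has_partial_derivative_def intro: DERIV_imp_deriv)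

lemma partial_vol: "\<forall>\<^sub>F y in nhds one. has_partial_derivative vol j (facet_area j y) y"
proof -
  obtain i where i: "cross3 (v j) (v i) \<noteq> 0" using exists_independent_vertex by blast
  show ?thesis
    using partial_vol_slice[OF i] eventually_facet_area_eq[OF i] by eventually_elim simp
qed

lemma partial_facet_area_cong:
  assumes n: "cross3 (v j) (v i) \<noteq> 0"
    and "\<forall>\<^sub>F y in nhds one. has_partial_derivative (facet_slice j i) k (g y) y"
  shows "\<forall>\<^sub>F y in nhds one. has_partial_derivative (facet_area j) k (g y) y"
proof -
  \<comment> \<open>Transferring a derivative at \<open>y\<close> needs agreement around
    \<open>y\<close>, hence the nested neighbourhoods.\<close>
  have "\<forall>\<^sub>F y in nhds one. \<forall>\<^sub>F z in nhds y. facet_area j z = facet_slice j i z"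
    using eventually_facet_area_eq[OF n] by (simp add: eventually_eventually)
  then show ?thesis
    using assms(2) by eventually_elim (simp add: has_partial_derivative_cong)
qed

text \<open>In the facet slice constraint \<open>i\<close> has become \<open>(1, 0)\<close>, so
  slicing applies again. Continuity at \<open>one\<close> is what the directional derivative will
  require.\<close>

lemma partial_facet_area_independent:
  assumes n: "cross3 (v j) (v i) \<noteq> 0"
  shows "\<forall>\<^sub>F y in nhds one. has_partial_derivative (facet_area j) i (edge_slice j i y) y"
    and "isCont (edge_slice j i) one"
proof -
  let ?w = "\<lambda>k. frame_coord (v j) (v i) (v k)"
  let ?z = "\<lambda>y. (\<chi> k. y $ k - fst (?w k) * y $ j) :: real^'n"
  let ?z2 = "\<lambda>z. (\<chi> k. z $ k - fst ((snd \<circ> ?w) k) * z $ i) :: real^'n"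
  have ij: "i \<noteq> j" using n by auto
  have wi: "(snd \<circ> ?w) i = (1, 0)" using frame_coord_self[OF n] by simp
  have bd: "bounded_system (UNIV - {j}) (snd \<circ> ?w)"
    by (intro bounded_system_slice bounded_system_frame bounded_system_vertices n frame_coord_self(1)[folded zero_prod_def])
  have cont: "isCont (\<lambda>y. ?z2 (?z y)) one"
    by (rule isCont_o2[where g="?z2"]) (rule isCont_shear)+
  have "\<forall>\<^sub>F y in nhds one. nondegenerate (UNIV - {j} - {i}) (snd \<circ> (snd \<circ> ?w)) (?z2 (?z y))"
    by (rule eventually_nondegenerate[OF nondegenerate_edge[OF n] cont])
  then have "\<forall>\<^sub>F y in nhds one. has_partial_derivative (facet_slice j i) i (edge_slice j i y) y"
  proof eventually_elim
    case (elim y)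
    show ?case
      unfolding facet_slice_def edge_slice_def Let_def
      by (intro has_partial_derivative_divide has_partial_derivative_shear[OF _ ij]
            has_partial_derivative_halfspace_volume bd wi elim) (use ij in simp)
  qed
  then show "\<forall>\<^sub>F y in nhds one. has_partial_derivative (facet_area j) i (edge_slice j i y) y"
    by (rule partial_facet_area_cong[OF n])
  have "isCont (\<lambda>y. halfspace_volume (UNIV - {j} - {i}) (snd \<circ> (snd \<circ> ?w)) (?z2 (?z y))) one"
    by (rule isCont_o2[OF cont])
      (rule isCont_halfspace_volume[OF bounded_system_slice[OF bd wi] nondegenerate_edge[OF n]])
  then show "isCont (edge_slice j i) one"
    unfolding edge_slice_def Let_def using n by (intro isCont_divide) auto
qed

text \<open>Inside a slice along \<open>v j\<close>, constraint \<open>i\<close> has zero normal and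
  reads \<open>0 \<le> y $ i - \<alpha> * y $ j\<close>. As \<open>\<alpha> \<noteq> 1\<close>, its
  truth value is constant near \<open>one\<close>, so the facet area does not depend on
  \<open>y $ i\<close> there.\<close>

lemma partial_facet_area_parallel:
  assumes par: "cross3 (v j) (v i) = 0" and ij: "i \<noteq> j"
  shows "\<forall>\<^sub>F y in nhds one. has_partial_derivative (facet_area j) i 0 y"
proof -
  obtain m where n: "cross3 (v j) (v m) \<noteq> 0" using exists_independent_vertex by blast
  let ?w = "\<lambda>k. frame_coord (v j) (v m) (v k)"
  define \<alpha> where "\<alpha> = fst (?w i)"
  have wi: "snd (?w i) = 0" using par by (rule snd_frame_coord_eq_0)
  have \<alpha>: "\<alpha> \<noteq> 1"
    using nondegenerate_facet[OF n] ij wi unfolding nondegenerate_def \<alpha>_def by auto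
  \<comment> \<open>On \<open>U\<close> the difference \<open>y $ i - \<alpha> * y $ j\<close> keeps
    the sign \<open>1 - \<alpha>\<close> that it has at \<open>one\<close>.\<close>
  define U where "U = {y :: real^'n. 0 < (1 - \<alpha>) * (y $ i - \<alpha> * y $ j)}"
  have "open U" unfolding U_def by (intro open_Collect_less continuous_intros)
  moreover have "one \<in> U" using \<alpha> by (simp add: U_def zero_less_mult_iff) linarith
  ultimately have "\<forall>\<^sub>F y in nhds one. y \<in> U" by (rule eventually_nhds_in_open)
  \<comment> \<open>On \<open>U\<close> constraint \<open>i\<close> is vacuous if
    \<open>\<alpha> < 1\<close> and empties the slice if \<open>\<alpha> > 1\<close>, so
    \<open>F\<close> can be written without \<open>y $ i\<close>.\<close>
  define F where "F y = (if \<alpha> < 1 then halfspace_volume (UNIV - {j} - {i}) (snd \<circ> ?w) (\<chi> k. y $ k - fst (?w k) * y $ j)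
      / (cross3 (v j) (v m) \<bullet> cross3 (v j) (v m)) else 0)" for y
  have F: "facet_slice j m y = F y" if "y \<in> U" for y
  proof (cases "\<alpha> < 1")
    case True
    then have "y $ i - \<alpha> * y $ j > 0" using that by (simp add: U_def zero_less_mult_iff)
    then have "{p. \<forall>k\<in>UNIV - {j}. (snd \<circ> ?w) k \<bullet> p \<le> (\<chi> k. y $ k - fst (?w k) * y $ j) $ k}
        = {p. \<forall>k\<in>UNIV - {j} - {i}. (snd \<circ> ?w) k \<bullet> p \<le> (\<chi> k. y $ k - fst (?w k) * y $ j) $ k}"
      using wi by (force simp: \<alpha>_def)
    then show ?thesis using True by (simp add: F_def facet_slice_def Let_def halfspace_volume_def)
  next
    case False
    then have "y $ i - \<alpha> * y $ j < 0" using that by (simp add: U_def zero_less_mult_iff)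
    then have "{p. \<forall>k\<in>UNIV - {j}. (snd \<circ> ?w) k \<bullet> p \<le> (\<chi> k. y $ k - fst (?w k) * y $ j) $ k} = {}"
      using wi ij by (force simp: \<alpha>_def)
    then show ?thesis
      unfolding facet_slice_def Let_def halfspace_volume_def using False by (simp only: measure_empty F_def) simp
  qed
  have "F (y + t *\<^sub>R axis i 1) = F y" for y t
  proof -
    have "{p. \<forall>k\<in>UNIV - {j} - {i}. (snd \<circ> ?w) k \<bullet> p
          \<le> (\<chi> k. (y + t *\<^sub>R axis i 1) $ k - fst (?w k) * (y + t *\<^sub>R axis i 1) $ j) $ k}
      = {p. \<forall>k\<in>UNIV - {j} - {i}. (snd \<circ> ?w) k \<bullet> p \<le> (\<chi> k. y $ k - fst (?w k) * y $ j) $ k}"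
      using ij by (auto simp: axis_def)
    then show ?thesis unfolding F_def halfspace_volume_def by (simp only:)
  qed
  then have F': "has_partial_derivative F i 0 y" for y by (simp add: has_partial_derivative_def)
  have "\<forall>\<^sub>F y in nhds one. has_partial_derivative (facet_slice j m) i 0 y"
    using \<open>\<forall>\<^sub>F y in nhds one. y \<in> U\<close>
  proof eventually_elim
    case (elim y)
    have "\<forall>\<^sub>F z in nhds y. facet_slice j m z = F z"
      using eventually_nhds_in_open[OF \<open>open U\<close> elim] by eventually_elim (rule F)
    then show ?case using F' by (simp add: has_partial_derivative_cong)
  qed
  then show ?thesis by (rule partial_facet_area_cong[OF n])
qed

text \<open>The value 0 is for parallel normals, where the frame behind \<open>edge_slice\<close>
  degenerates.\<close>

definition mixed_derivative :: "'n \<Rightarrow> 'n \<Rightarrow> real^'n \<Rightarrow> real" where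
  "mixed_derivative j i y = (if cross3 (v j) (v i) = 0 then 0 else edge_slice j i y)"

lemma partial_facet_area:
  assumes "i \<noteq> j"
  shows "\<forall>\<^sub>F y in nhds one. has_partial_derivative (facet_area j) i (mixed_derivative j i y) y"
    and "isCont (mixed_derivative j i) one"
  using assms partial_facet_area_independent[of j i] partial_facet_area_parallel[of j i]
  by (cases "cross3 (v j) (v i) = 0"; simp add: mixed_derivative_def[abs_def])+

section \<open>Translations and the diagonal derivative\<close>

lemma facet_area_translate: "facet_area j (y + (\<chi> k. v k \<bullet> q)) = facet_area j y"
proof -
  have "vol (y + (\<chi> k. v k \<bullet> q) + t *\<^sub>R axis j 1) = vol (y + t *\<^sub>R axis j 1)" for t
    using measure_constraint_polyhedron_translate[of v "y + t *\<^sub>R axis j 1" q]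
    unfolding vol_def by (simp add: algebra_simps)
  then show ?thesis by (simp only: facet_area_def)
qed

text \<open>Up to a translation by \<open>t *\<^sub>R q\<close>, moving component \<open>j\<close>
  by \<open>t * (v j \<bullet> q)\<close> amounts to moving every other component \<open>k\<close>
  by \<open>- t * (v k \<bullet> q)\<close>, and in those directions the partial derivatives are
  known.\<close>

lemma facet_area_derivative_along_normal:
  "((\<lambda>t. facet_area j (one + (t * (v j \<bullet> q)) *\<^sub>R axis j 1))
     has_real_derivative - ((\<Sum>k\<in>UNIV - {j}. mixed_derivative j k one *\<^sub>R v k) \<bullet> q)) (at 0)"
proof -
  define U :: "real^'n" where "U = (\<Sum>k\<in>UNIV - {j}. (- (v k \<bullet> q)) *\<^sub>R axis k 1)"
  have U: "U $ l = (if l = j then 0 else - (v l \<bullet> q))" for l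
    by (simp add: U_def axis_def if_distrib[of "\<lambda>x. _ * x"] sum.delta' sum_negf cong: if_cong)
  have "((\<lambda>t. facet_area j (one + t *\<^sub>R U)) has_real_derivative
      (\<Sum>k\<in>UNIV - {j}. (- (v k \<bullet> q)) * mixed_derivative j k one)) (at 0)"
    unfolding U_def by (rule has_real_derivative_directional) (auto intro: partial_facet_area)
  moreover have "(\<Sum>k\<in>UNIV - {j}. (- (v k \<bullet> q)) * mixed_derivative j k one) = - ((\<Sum>k\<in>UNIV - {j}. mixed_derivative j k one *\<^sub>R v k) \<bullet> q)"
    by (simp add: inner_sum_left sum_negf mult.commute)
  moreover have "facet_area j (one + (t * (v j \<bullet> q)) *\<^sub>R axis j 1) = facet_area j (one + t *\<^sub>R U)" for t
  proof -
    have "one + (t * (v j \<bullet> q)) *\<^sub>R axis j 1 = (one + t *\<^sub>R U) + (\<chi> k. v k \<bullet> (t *\<^sub>R q))"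
      by (simp add: vec_eq_iff U axis_def)
    then show ?thesis by (simp only: facet_area_translate)
  qed
  ultimately show ?thesis by simp
qed

lemma facet_area_diagonal:
  obtains c where "(\<Sum>k\<in>UNIV - {j}. mixed_derivative j k one *\<^sub>R v k) = c *\<^sub>R v j"
    and "has_partial_derivative (facet_area j) j (- c) one"
proof
  let ?S = "\<Sum>k\<in>UNIV - {j}. mixed_derivative j k one *\<^sub>R v k"
  define c where "c = (?S \<bullet> v j) / (v j \<bullet> v j)"
  have nz: "v j \<bullet> v j \<noteq> 0" using vertex_nonzero by simp
  \<comment> \<open>The part of the sum orthogonal to \<open>v j\<close>: for this \<open>q\<close>
    component \<open>j\<close> does not move, so the derivative \<open>- (?S \<bullet> q)\<close>,
    which equals \<open>- (q \<bullet> q)\<close>, vanishes.\<close>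
  define q where "q = ?S - c *\<^sub>R v j"
  have q: "v j \<bullet> q = 0" using nz by (simp add: q_def c_def inner_diff_right inner_commute)
  have "((\<lambda>t. facet_area j one) has_real_derivative - (?S \<bullet> q)) (at 0)"
    using facet_area_derivative_along_normal[of j q] by (simp add: q)
  from DERIV_unique[OF this DERIV_const] have "?S \<bullet> q = 0" by simp
  then have "q \<bullet> q = 0" using q by (simp add: q_def inner_diff_left inner_diff_right inner_commute)
  then show "?S = c *\<^sub>R v j" by (simp add: q_def)
  \<comment> \<open>The chosen multiple \<open>q\<close> of \<open>v j\<close> has
    \<open>v j \<bullet> q = 1\<close>, so component \<open>j\<close> moves at unit speed.\<close>
  show "has_partial_derivative (facet_area j) j (- c) one"
    using facet_area_derivative_along_normal[of j "(1 / (v j \<bullet> v j)) *\<^sub>R v j"] nz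
    by (simp add: has_partial_derivative_def c_def)
qed

section \<open>Edges of the polytope and of its polar dual\<close>

lemma proper_face:
  assumes "aff_dim F < 3"
  shows "F \<noteq> Q"
  using assms aff_dim by auto

lemma supported_face:
  assumes "\<And>k. v k \<bullet> p \<le> 1"
  shows "{y \<in> Q. y \<bullet> p = 1} face_of Q"
proof -
  have "Q \<inter> {y. p \<bullet> y = 1} face_of Q"
    using polytope_imp_convex[OF polytope] inner_le[OF _ assms]
    by (intro face_of_Int_supporting_hyperplane_le) (auto simp: inner_commute)
  moreover have "Q \<inter> {y. p \<bullet> y = 1} = {y \<in> Q. y \<bullet> p = 1}" by (auto simp: inner_commute)
  ultimately show ?thesis by simp
qed

lemma supported_face_hull:
  assumes "\<And>k. v k \<bullet> p \<le> 1"
  shows "{y \<in> Q. y \<bullet> p = 1} = convex hull (v ` {k. v k \<bullet> p = 1})" (is "?F = ?H")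
proof
  have "?F face_of convex hull (range v)" using supported_face[OF assms] hull_vertices by simp
  then obtain S where S: "S \<subseteq> range v" "?F = convex hull S"
    by (rule face_of_convex_hull_subset[rotated]) (auto intro: finite_imp_compact)
  have "S \<subseteq> ?F" using S(2) hull_subset by metis
  then have "S \<subseteq> v ` {k. v k \<bullet> p = 1}" using S(1) by auto
  then show "?F \<subseteq> ?H" using S(2) hull_mono by metis
  show "?H \<subseteq> ?F"
    by (rule hull_minimal) (use vertex_in face_of_imp_convex[OF supported_face[OF assms]] in auto)
qed

text \<open>Faces of a polyhedron are exposed by some plane \<open>a \<bullet> x = b\<close>; as the
  origin is interior, \<open>b > 0\<close>, and the plane scales to the point \<open>a / b\<close>
  of the polar dual.\<close>

lemma proper_face_supported:
  assumes F: "F face_of Q" "F \<noteq> Q" "F \<noteq> {}"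
  obtains p where "\<And>k. v k \<bullet> p \<le> 1" and "F = {y \<in> Q. y \<bullet> p = 1}"
proof -
  obtain a b where ab: "Q \<subseteq> {x. a \<bullet> x \<le> b}" "F = Q \<inter> {x. a \<bullet> x = b}"
    using F(1) exposed_face_of_polyhedron[OF polytope_imp_polyhedron[OF polytope]]
    unfolding exposed_face_of_def by blast
  have "0 \<in> Q" using zero_interior interior_subset by blast
  moreover have "0 \<notin> F" using face_of_disjoint_interior[OF F(1,2)] zero_interior by blast
  ultimately have "b > 0" using ab by (auto simp: less_le)
  show thesis
  proof (rule that[of "(1 / b) *\<^sub>R a"])
    show "v k \<bullet> ((1 / b) *\<^sub>R a) \<le> 1" for k
      using ab(1) vertex_in[of k] \<open>b > 0\<close> by (auto simp: inner_commute)
    show "F = {y \<in> Q. y \<bullet> ((1 / b) *\<^sub>R a) = 1}"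
      using ab(2) \<open>b > 0\<close> by (auto simp: inner_commute)
  qed
qed

lemma aff_dim_vertex_segment:
  assumes "i \<noteq> j"
  shows "aff_dim (closed_segment (v i) (v j)) = 1"
  using assms inj_vertices by (auto simp: segment_convex_hull aff_dim_convex_hull aff_dim_2 inj_eq)

text \<open>Under polarity a witness \<open>p\<close> is a relatively interior point of the dual
  edge, where no further constraint is tight.\<close>

lemma adjacent_iff_supported:
  "skeleton_adj Q v i j \<longleftrightarrow> i \<noteq> j \<and> (\<exists>p. (\<forall>k. v k \<bullet> p \<le> 1) \<and> {k. v k \<bullet> p = 1} = {i, j})"
proof (cases "i = j")
  case False
  show ?thesis
  proof
    assume "skeleton_adj Q v i j"
    then have face: "closed_segment (v i) (v j) face_of Q"
      by (simp add: skeleton_adj_def edge_of_def)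
    have "closed_segment (v i) (v j) \<noteq> Q"
      by (rule proper_face) (simp add: aff_dim_vertex_segment[OF False])
    then obtain p where p: "\<And>k. v k \<bullet> p \<le> 1" "closed_segment (v i) (v j) = {y \<in> Q. y \<bullet> p = 1}"
      using proper_face_supported[OF face] by auto
    have "v k \<bullet> p = 1 \<longleftrightarrow> k = i \<or> k = j" for k
    proof
      assume "v k \<bullet> p = 1"
      then have "v k \<in> closed_segment (v i) (v j)" using p(2) vertex_in by auto
      moreover have "v k \<notin> open_segment (v i) (v j)"
        using extreme_vertex[of k] vertex_in unfolding extreme_point_of_def by blast
      ultimately have "v k = v i \<or> v k = v j" by (auto simp: open_segment_def)
      then show "k = i \<or> k = j" using inj_vertices by (auto dest: injD)
    next
      assume "k = i \<or> k = j"
      then have "v k \<in> closed_segment (v i) (v j)" by auto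
      then show "v k \<bullet> p = 1" using p(2) by auto
    qed
    then show "i \<noteq> j \<and> (\<exists>p. (\<forall>k. v k \<bullet> p \<le> 1) \<and> {k. v k \<bullet> p = 1} = {i, j})"
      using False p(1) by auto
  next
    assume "i \<noteq> j \<and> (\<exists>p. (\<forall>k. v k \<bullet> p \<le> 1) \<and> {k. v k \<bullet> p = 1} = {i, j})"
    then obtain p where p: "\<And>k. v k \<bullet> p \<le> 1" "{k. v k \<bullet> p = 1} = {i, j}" by auto
    have "{y \<in> Q. y \<bullet> p = 1} = closed_segment (v i) (v j)"
      using supported_face_hull[OF p(1)] p(2) by (simp add: segment_convex_hull)
    then have "closed_segment (v i) (v j) face_of Q" using supported_face[OF p(1)] by simp
    then show "skeleton_adj Q v i j"
      using False by (simp add: skeleton_adj_def edge_of_def aff_dim_vertex_segment)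
  qed
qed (simp add: skeleton_adj_def)

text \<open>Both vertices lie on a plane missing the origin, where proportional points
  coincide.\<close>

lemma adjacent_independent:
  assumes "skeleton_adj Q v j i"
  shows "cross3 (v j) (v i) \<noteq> 0"
proof
  assume "cross3 (v j) (v i) = 0"
  then obtain c where c: "v i = c *\<^sub>R v j"
    using vertex_nonzero by (auto simp: cross_eq_0 collinear_lemma)
  from assms obtain p where "{k. v k \<bullet> p = 1} = {j, i}" and "i \<noteq> j"
    unfolding adjacent_iff_supported by auto
  then have "v i \<bullet> p = 1" "v j \<bullet> p = 1" by auto
  then have "v i = v j" using c by simp
  then show False using \<open>i \<noteq> j\<close> inj_vertices by (auto dest: injD)
qed

text \<open>For independent \<open>v j\<close> and \<open>v i\<close>, \<open>edge_point j i\<close> maps \<open>edge_params j i\<close> onto the face of the polar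
  dual on which both constraints are tight, that is, the dual edge if \<open>j\<close> and \<open>i\<close> are adjacent.\<close>

definition edge_point :: "'n \<Rightarrow> 'n \<Rightarrow> real \<Rightarrow> real^3" where
  "edge_point j i c = frame_point (v j) (v i) (1, 1, c)"

definition edge_params :: "'n \<Rightarrow> 'n \<Rightarrow> real set" where
  "edge_params j i = {c. \<forall>k. v k \<bullet> edge_point j i c \<le> 1}"

text \<open>With \<open>B = 0\<close> and \<open>A = 1\<close> constraint \<open>k\<close> is tight
  on the whole line of edge points, so \<open>v k\<close> lies on the line through
  \<open>v j\<close> and \<open>v i\<close>.\<close>

lemma edge_point_affine:
  obtains A B where "\<And>c. v k \<bullet> edge_point j i c = A + B * c"
    and "B = 0 \<Longrightarrow> cross3 (v j) (v i) \<noteq> 0 \<Longrightarrow> A = 1 \<Longrightarrow> i \<noteq> j \<Longrightarrow> k = i \<or> k = j"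
proof -
  obtain \<alpha> \<beta> \<gamma> where w: "frame_coord (v j) (v i) (v k) = (\<alpha>, \<beta>, \<gamma>)" by (metis prod_cases3)
  show thesis
  proof (rule that[of "\<alpha> + \<beta>" \<gamma>])
    show "v k \<bullet> edge_point j i c = \<alpha> + \<beta> + \<gamma> * c" for c
      unfolding edge_point_def frame_coord_inner[symmetric] w by (simp add: inner_prod_def)
    show "k = i \<or> k = j" if "\<gamma> = 0" "cross3 (v j) (v i) \<noteq> 0" "\<alpha> + \<beta> = 1" "i \<noteq> j"
      using not_collinear_vertices[of k \<alpha> j \<beta> i] frame_coord_expand[OF that(2) w] that by simp
  qed
qed

section \<open>The dual edge of two independent vertices\<close>

context
  fixes j i
  assumes indep: "cross3 (v j) (v i) \<noteq> 0"
begin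

lemma distinct: "i \<noteq> j"
  using indep by auto

lemma edge_point_ends: "v j \<bullet> edge_point j i c = 1" "v i \<bullet> edge_point j i c = 1"
  unfolding edge_point_def by (rule inner_frame_point[OF indep])+

lemma edge_point_cases:
  assumes "v j \<bullet> p = 1" and "v i \<bullet> p = 1"
  obtains c where "p = edge_point j i c"
  using frame_point_expand[OF indep, of p] assms unfolding edge_point_def by metis

lemma edge_point_diff:
  "edge_point j i c - edge_point j i d
    = ((c - d) / (cross3 (v j) (v i) \<bullet> cross3 (v j) (v i))) *\<^sub>R cross3 (v j) (v i)"
  by (simp add: edge_point_def frame_point_def Let_def diff_divide_distrib scaleR_diff_left)

lemma edge_point_inject: "edge_point j i c = edge_point j i d \<longleftrightarrow> c = d"
  using edge_point_diff[of c d] indep by auto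

text \<open>A third tight constraint has nonzero slope along the line of edge points, so it pins
  down the parameter.\<close>

lemma tight_unique:
  assumes k: "k \<noteq> i" "k \<noteq> j" and "v k \<bullet> edge_point j i c = 1"
    and "v j \<bullet> p = 1" "v i \<bullet> p = 1" "v k \<bullet> p = 1"
  shows "p = edge_point j i c"
proof -
  obtain d where d: "p = edge_point j i d" using edge_point_cases assms(4,5) by blast
  obtain A B where AB: "\<And>c. v k \<bullet> edge_point j i c = A + B * c"
    and "B = 0 \<Longrightarrow> A = 1 \<Longrightarrow> k = i \<or> k = j"
    using edge_point_affine[of k j i] indep distinct by metis
  then have "B \<noteq> 0" using assms(3) k by auto
  moreover have "B * c = B * d" using AB[of c] AB[of d] assms(3,6) unfolding d by linarith
  ultimately show ?thesis using d by simp
qed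

text \<open>An affine function that is at most 1 at both ends and equals 1 in between is
  constant.\<close>

lemma interior_param_tight:
  assumes "c1 \<in> edge_params j i" "c2 \<in> edge_params j i" "c1 < c" "c < c2"
  shows "{k. v k \<bullet> edge_point j i c = 1} = {j, i}"
proof
  show "{k. v k \<bullet> edge_point j i c = 1} \<subseteq> {j, i}"
  proof
    fix k assume "k \<in> {k. v k \<bullet> edge_point j i c = 1}"
    then have k: "v k \<bullet> edge_point j i c = 1" by simp
    obtain A B where AB: "\<And>c. v k \<bullet> edge_point j i c = A + B * c"
      and B0: "B = 0 \<Longrightarrow> A = 1 \<Longrightarrow> k = i \<or> k = j"
      using edge_point_affine[of k j i] indep distinct by metis
    have "A + B * c = 1" "A + B * c1 \<le> 1" "A + B * c2 \<le> 1"
      using k assms(1,2) by (auto simp: AB[symmetric] edge_params_def)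
    then have "B * (c1 - c) \<le> 0" "B * (c2 - c) \<le> 0" by (simp_all add: algebra_simps)
    then have "B = 0" using assms(3,4) by (simp add: mult_le_0_iff)
    then show "k \<in> {j, i}" using B0 \<open>A + B * c = 1\<close> by auto
  qed
qed (auto simp: edge_point_ends)

text \<open>Finitely many strict inequalities survive a small change of the parameter. This shows
  both that a dual edge has positive length and that it ends only where a third constraint is
  tight.\<close>

lemma edge_params_open:
  assumes "c \<in> edge_params j i" and "\<And>k. k \<noteq> i \<Longrightarrow> k \<noteq> j \<Longrightarrow> v k \<bullet> edge_point j i c < 1"
  obtains \<delta> where "\<delta> > 0" "c - \<delta> \<in> edge_params j i" "c + \<delta> \<in> edge_params j i"
proof -
  have "\<forall>\<^sub>F d in nhds c. v k \<bullet> edge_point j i d \<le> 1" for k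
  proof (cases "k = i \<or> k = j")
    case True
    then show ?thesis using edge_point_ends by auto
  next
    case False
    obtain A B where AB: "\<And>c. v k \<bullet> edge_point j i c = A + B * c"
      using edge_point_affine[of k j i] by metis
    have "((\<lambda>d. A + B * d) \<longlongrightarrow> A + B * c) (nhds c)"
      by (intro tendsto_intros filterlim_ident)
    then have "\<forall>\<^sub>F d in nhds c. A + B * d < 1"
      using assms(2) False by (intro order_tendstoD) (auto simp: AB[symmetric])
    then show ?thesis unfolding AB by eventually_elim simp
  qed
  then have "\<forall>\<^sub>F d in nhds c. d \<in> edge_params j i"
    by (simp add: edge_params_def eventually_all_finite)
  then obtain e where e: "e > 0" "\<And>d. dist d c < e \<Longrightarrow> d \<in> edge_params j i"
    by (auto simp: eventually_nhds_metric)
  show thesis using e by (intro that[of "e / 2"]) (auto simp: dist_norm)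
qed

text \<open>An intersection of closed convex sets, bounded because the polar dual is;
  \<open>c1 > c2\<close> covers the empty set.\<close>

lemma edge_params_interval: "\<exists>c1 c2. edge_params j i = {c1..c2}"
proof -
  have closed: "closed (edge_params j i)" and convex: "convex (edge_params j i)"
  proof -
    have "closed {c. v k \<bullet> edge_point j i c \<le> 1} \<and> convex {c. v k \<bullet> edge_point j i c \<le> 1}" for k
    proof -
      obtain A B where AB: "\<And>c. v k \<bullet> edge_point j i c = A + B * c"
        using edge_point_affine[of k j i] by metis
      have "{c. v k \<bullet> edge_point j i c \<le> 1} = {c. B \<bullet> c \<le> 1 - A}" by (auto simp: AB)
      then show ?thesis by (simp only: closed_halfspace_le convex_halfspace_le)
    qed
    moreover have "edge_params j i = (\<Inter>k. {c. v k \<bullet> edge_point j i c \<le> 1})"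
      by (auto simp: edge_params_def)
    ultimately show "closed (edge_params j i)" "convex (edge_params j i)"
      by (auto intro: convex_INT)
  qed
  obtain B where B: "\<And>p. (\<forall>k\<in>UNIV. v k \<bullet> p \<le> 1) \<Longrightarrow> norm p \<le> B"
    using bounded_system_vertices unfolding bounded_system_def bounded_iff by blast
  have "norm c \<le> norm (cross3 (v j) (v i)) * B" if "c \<in> edge_params j i" for c
  proof -
    \<comment> \<open>The parameter is an inner product with the edge point, so a bound on the
      points bounds it.\<close>
    have "c = cross3 (v j) (v i) \<bullet> edge_point j i c"
      unfolding edge_point_def by (rule inner_frame_point(3)[OF indep, symmetric])
    then have "norm c \<le> norm (cross3 (v j) (v i)) * norm (edge_point j i c)"
      using Cauchy_Schwarz_ineq2 by (metis real_norm_def)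
    also have "\<dots> \<le> norm (cross3 (v j) (v i)) * B"
      using B that by (intro mult_left_mono) (auto simp: edge_params_def)
    finally show ?thesis .
  qed
  then have "bounded (edge_params j i)" unfolding bounded_iff by blast
  then show ?thesis
    using closed convex connected_compact_interval_1[of "edge_params j i"]
    by (simp add: compact_eq_bounded_closed convex_connected)
qed

text \<open>The constraints left after slicing twice are those defining \<open>edge_params\<close>;
  \<open>j\<close> and \<open>i\<close> can be put back because they hold with equality at all edge
  points.\<close>

lemma edge_slice_eq:
  "edge_slice j i one = measure lborel (edge_params j i) / (cross3 (v j) (v i) \<bullet> cross3 (v j) (v i))"
proof -
  let ?w = "\<lambda>k. frame_coord (v j) (v i) (v k)"
  have w: "v k \<bullet> edge_point j i c = fst (?w k) + fst (snd (?w k)) + snd (snd (?w k)) * c" for k c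
    unfolding edge_point_def frame_coord_inner[symmetric] by (simp add: inner_prod_def)
  have "?w i = (0, 1, 0)" by (rule frame_coord_self[OF indep])
  then have "{c. \<forall>k\<in>UNIV - {j} - {i}. (snd \<circ> (snd \<circ> ?w)) k \<bullet> c \<le> 1 - fst (?w k) - fst (snd (?w k))}
      = edge_params j i"
    unfolding edge_params_def
  proof (intro Collect_cong iffI allI ballI)
    fix c k assume *: "\<forall>k\<in>UNIV - {j} - {i}. (snd \<circ> (snd \<circ> ?w)) k \<bullet> c \<le> 1 - fst (?w k) - fst (snd (?w k))"
    show "v k \<bullet> edge_point j i c \<le> 1"
    proof (cases "k = i \<or> k = j")
      case False
      then show ?thesis using * by (auto simp: w algebra_simps)
    qed (auto simp: edge_point_ends)
  next
    fix c k assume "\<forall>k. v k \<bullet> edge_point j i c \<le> 1"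
    then have "v k \<bullet> edge_point j i c \<le> 1" ..
    then show "(snd \<circ> (snd \<circ> ?w)) k \<bullet> c \<le> 1 - fst (?w k) - fst (snd (?w k))"
      by (simp add: w algebra_simps)
  qed
  with \<open>?w i = (0, 1, 0)\<close> show ?thesis
    by (simp add: edge_slice_def Let_def halfspace_volume_def)
qed

text \<open>The face contains three noncollinear vertices and lies in a plane, so its dimension is
  2; the same three tight constraints determine the edge point, which is therefore extreme in the
  polar dual.\<close>

lemma tight_vertex_face:
  assumes c: "c \<in> edge_params j i" and k: "k \<noteq> i" "k \<noteq> j" and tight: "v k \<bullet> edge_point j i c = 1"
  defines "F \<equiv> {y \<in> Q. y \<bullet> edge_point j i c = 1}"
  shows "F \<in> faces2 Q" and "closed_segment (v j) (v i) \<subseteq> F"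
    and "dual_vertex Q v F = edge_point j i c"
proof -
  let ?p = "edge_point j i c"
  have le: "v l \<bullet> ?p \<le> 1" for l using c by (simp add: edge_params_def)
  have face: "F face_of Q" unfolding F_def by (rule supported_face[OF le])
  have mem: "v j \<in> F" "v i \<in> F" "v k \<in> F"
    using vertex_in edge_point_ends tight by (auto simp: F_def)
  show "closed_segment (v j) (v i) \<subseteq> F"
    using mem face_of_imp_convex[OF face] by (simp add: closed_segment_subset)
  have "\<not> collinear {v j, v k, v i}"
  proof
    assume "collinear {v j, v k, v i}"
    then obtain u where "v j = v i \<or> v k = u *\<^sub>R v j + (1 - u) *\<^sub>R v i"
      unfolding collinear_3_expand by blast
    then show False
      using not_collinear_vertices[of k u j "1 - u" i] distinct k inj_vertices by (auto dest: injD)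
  qed
  then have "\<not> affine_dependent {v j, v k, v i}" and "card {v j, v k, v i} = 3"
    by (auto simp: collinear_3_eq_affine_dependent)
  then have "aff_dim {v j, v k, v i} = 2"
    using aff_dim_affine_independent[of "{v j, v k, v i}"] by linarith
  moreover have "aff_dim {v j, v k, v i} \<le> aff_dim F"
    using mem by (intro aff_dim_subset) auto
  moreover have "?p \<noteq> 0" using tight by auto
  then have "aff_dim F \<le> 2"
    using aff_dim_subset[of F "{y. ?p \<bullet> y = 1}"] aff_dim_hyperplane[of ?p 1]
    by (auto simp: F_def inner_commute)
  ultimately show "F \<in> faces2 Q" using face by (simp add: faces2_def)
  have unique: "p = ?p" if "v j \<bullet> p = 1" "v i \<bullet> p = 1" "v k \<bullet> p = 1" for p
    using tight_unique[OF k tight that] .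
  have polar: "polar_dual v = {p. \<forall>l. v l \<bullet> p \<le> 1}"
    by (simp add: polar_dual_def constraint_polyhedron_def)
  have "?p extreme_point_of polar_dual v"
    unfolding extreme_point_of_def
  proof (intro conjI ballI notI)
    show "?p \<in> polar_dual v" using le by (simp add: polar)
    fix a b assume ab: "a \<in> polar_dual v" "b \<in> polar_dual v" and "?p \<in> open_segment a b"
    then obtain u where u: "a \<noteq> b" "0 < u" "u < 1" "?p = (1 - u) *\<^sub>R a + u *\<^sub>R b"
      by (auto simp: in_segment)
    \<comment> \<open>An upper bound attained at a proper convex combination is attained at both
      ends.\<close>
    have "v l \<bullet> a = 1 \<and> v l \<bullet> b = 1" if "v l \<bullet> ?p = 1" for l
    proof -
      have "(1 - u) * (1 - v l \<bullet> a) + u * (1 - v l \<bullet> b) = 0"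
        using that u(4) by (simp add: inner_add_right algebra_simps)
      moreover have "(1 - u) * (1 - v l \<bullet> a) \<ge> 0" "u * (1 - v l \<bullet> b) \<ge> 0"
        using ab u by (auto simp: polar)
      ultimately have "(1 - u) * (1 - v l \<bullet> a) = 0" "u * (1 - v l \<bullet> b) = 0" by linarith+
      then show ?thesis using u by simp
    qed
    then have "a = ?p" "b = ?p" using unique edge_point_ends tight by auto
    then show False using u(1) by simp
  qed
  then show "dual_vertex Q v F = ?p"
    unfolding dual_vertex_def
  proof (intro the_equality)
    fix w assume w: "w extreme_point_of polar_dual v \<and> F = {y \<in> Q. y \<bullet> w = 1}"
    then show "w = ?p" using mem by (intro unique) auto
  qed (simp add: F_def)
qed

text \<open>The ends \<open>c1 < c2\<close> of the parameter interval give the dual vertices of the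
  two faces at the edge, and their difference carries the factor
  \<open>(c1 - c2) / (?n \<bullet> ?n)\<close>, the negative of the edge slice.\<close>

lemma lovasz_offdiag_adjacent:
  assumes adj: "skeleton_adj Q v j i"
  shows "lovasz_offdiag Q v j i = - edge_slice j i one"
proof -
  let ?n = "cross3 (v j) (v i)"
  let ?F = "\<lambda>c. {y \<in> Q. y \<bullet> edge_point j i c = 1}"
  obtain c1 c2 where I: "edge_params j i = {c1..c2}" using edge_params_interval by blast
  obtain p where p: "\<And>k. v k \<bullet> p \<le> 1" "{k. v k \<bullet> p = 1} = {j, i}"
    using adj unfolding adjacent_iff_supported by auto
  then have "v j \<bullet> p = 1" "v i \<bullet> p = 1" by auto
  then obtain c where c: "p = edge_point j i c" by (rule edge_point_cases)
  have "c \<in> edge_params j i" using p(1) c by (simp add: edge_params_def)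
  moreover have "v k \<bullet> edge_point j i c < 1" if "k \<noteq> i" "k \<noteq> j" for k
    using p that unfolding c less_le by auto
  ultimately obtain \<delta> where "\<delta> > 0" "c - \<delta> \<in> edge_params j i" "c + \<delta> \<in> edge_params j i"
    by (rule edge_params_open)
  then have "c1 < c2" using I by auto
  \<comment> \<open>If only \<open>j\<close> and \<open>i\<close> were tight at an end, the interval
    would extend beyond it.\<close>
  have tight: "\<exists>k. k \<noteq> i \<and> k \<noteq> j \<and> v k \<bullet> edge_point j i d = 1" if "d = c1 \<or> d = c2" for d
  proof (rule ccontr)
    assume none: "\<not> ?thesis"
    have d: "d \<in> edge_params j i" using that I \<open>c1 < c2\<close> by auto
    then have "v k \<bullet> edge_point j i d < 1" if "k \<noteq> i" "k \<noteq> j" for k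
      using none that unfolding less_le by (auto simp: edge_params_def)
    with d obtain \<delta> where "\<delta> > 0" "d - \<delta> \<in> edge_params j i" "d + \<delta> \<in> edge_params j i"
      by (rule edge_params_open)
    then show False using I that by auto
  qed
  have ends: "?F d \<in> faces2 Q" "closed_segment (v j) (v i) \<subseteq> ?F d" "dual_vertex Q v (?F d) = edge_point j i d"
    if d: "d = c1 \<or> d = c2" for d
  proof -
    have "d \<in> edge_params j i" using d I \<open>c1 < c2\<close> by auto
    with tight[OF d] show "?F d \<in> faces2 Q" "closed_segment (v j) (v i) \<subseteq> ?F d"
      "dual_vertex Q v (?F d) = edge_point j i d"
      using tight_vertex_face by blast+
  qed
  have neq: "?F c1 \<noteq> ?F c2"
    using ends(3)[of c1] ends(3)[of c2] edge_point_inject[of c1 c2] \<open>c1 < c2\<close> by auto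
  have faces: "{F \<in> faces2 Q. closed_segment (v j) (v i) \<subseteq> F} = {?F c1, ?F c2}"
  proof
    show "{F \<in> faces2 Q. closed_segment (v j) (v i) \<subseteq> F} \<subseteq> {?F c1, ?F c2}"
    proof (rule subsetI)
      fix F assume "F \<in> {F \<in> faces2 Q. closed_segment (v j) (v i) \<subseteq> F}"
      then have F: "F \<in> faces2 Q" "closed_segment (v j) (v i) \<subseteq> F" by auto
      then have "F face_of Q" "aff_dim F = 2" by (auto simp: faces2_def)
      moreover from this have "F \<noteq> Q" by (intro proper_face) simp
      moreover have vF: "v j \<in> F" "v i \<in> F" using F(2) by auto
      ultimately obtain q where q: "\<And>k. v k \<bullet> q \<le> 1" "F = {y \<in> Q. y \<bullet> q = 1}"
        using proper_face_supported[of F] by blast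
      then have "v j \<bullet> q = 1" "v i \<bullet> q = 1" using vF by auto
      then obtain d where d: "q = edge_point j i d" by (rule edge_point_cases)
      have dI: "d \<in> {c1..c2}" using q(1) d I by (auto simp: edge_params_def)
      \<comment> \<open>Strictly inside the interval only \<open>j\<close> and \<open>i\<close> are
        tight, so the face would be the segment, of dimension 1.\<close>
      have "\<not> (c1 < d \<and> d < c2)"
      proof
        assume "c1 < d \<and> d < c2"
        then have "{k. v k \<bullet> q = 1} = {j, i}"
          unfolding d using I \<open>c1 < c2\<close> by (intro interior_param_tight[of c1 c2]) auto
        then have "F = closed_segment (v j) (v i)"
          using supported_face_hull[OF q(1)] q(2) by (simp add: segment_convex_hull)
        then show False using \<open>aff_dim F = 2\<close> aff_dim_vertex_segment[of j i] distinct by simp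
      qed
      then have "d = c1 \<or> d = c2" using dI by auto
      then show "F \<in> {?F c1, ?F c2}" using q(2) d by auto
    qed
  qed (use ends in auto)
  have diff: "dual_vertex Q v (?F c1) - dual_vertex Q v (?F c2) = ((c1 - c2) / (?n \<bullet> ?n)) *\<^sub>R ?n"
    "dual_vertex Q v (?F c2) - dual_vertex Q v (?F c1) = ((c2 - c1) / (?n \<bullet> ?n)) *\<^sub>R ?n"
    using ends(3) edge_point_diff by simp_all
  have pos: "?n \<bullet> ?n > 0" using indep by simp
  \<comment> \<open>Taking the face of \<open>c1\<close> first gives the negative factor; the
    reverse labelling gives a positive one.\<close>
  have "lovasz_offdiag Q v j i = (c1 - c2) / (?n \<bullet> ?n)"
    unfolding lovasz_offdiag_def using adj
  proof (simp only: if_True, intro the_equality)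
    show "(c1 - c2) / (?n \<bullet> ?n) < 0 \<and> (\<exists>f g. f \<noteq> g \<and>
        {F \<in> faces2 Q. closed_segment (v j) (v i) \<subseteq> F} = {f, g} \<and>
        dual_vertex Q v f - dual_vertex Q v g = ((c1 - c2) / (?n \<bullet> ?n)) *\<^sub>R ?n)"
      using neq faces diff(1) pos \<open>c1 < c2\<close>
      by (intro conjI exI[of _ "?F c1"] exI[of _ "?F c2"]) (assumption | simp add: divide_neg_pos)+
  next
    fix m assume m: "m < 0 \<and> (\<exists>f g. f \<noteq> g \<and>
        {F \<in> faces2 Q. closed_segment (v j) (v i) \<subseteq> F} = {f, g} \<and>
        dual_vertex Q v f - dual_vertex Q v g = m *\<^sub>R ?n)"
    then obtain f g where "{?F c1, ?F c2} = {f, g}" and fg: "dual_vertex Q v f - dual_vertex Q v g = m *\<^sub>R ?n"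
      unfolding faces by auto
    then consider "f = ?F c1" "g = ?F c2" | "f = ?F c2" "g = ?F c1"
      by (auto simp: doubleton_eq_iff)
    then show "m = (c1 - c2) / (?n \<bullet> ?n)"
    proof cases
      case 1
      then show ?thesis using fg diff(1) indep by simp
    next
      case 2
      then have "m = (c2 - c1) / (?n \<bullet> ?n)" using fg diff(2) indep by simp
      then have "m > 0" using pos \<open>c1 < c2\<close> by simp
      then show ?thesis using m by simp
    qed
  qed
  moreover have "measure lborel (edge_params j i) = c2 - c1" using I \<open>c1 < c2\<close> by simp
  ultimately show ?thesis by (simp add: edge_slice_eq minus_divide_left)
qed

text \<open>A parameter strictly inside the interval would yield a supporting point that proves
  adjacency; the interval is therefore empty or a point.\<close>

lemma edge_slice_nonadjacent:
  assumes "\<not> skeleton_adj Q v j i"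
  shows "edge_slice j i one = 0"
proof -
  obtain c1 c2 where I: "edge_params j i = {c1..c2}" using edge_params_interval by blast
  have "\<not> c1 < c2"
  proof
    assume less: "c1 < c2"
    define c where "c = (c1 + c2) / 2"
    have c: "c1 < c" "c < c2" using less by (auto simp: c_def)
    then have "{k. v k \<bullet> edge_point j i c = 1} = {j, i}"
      using I by (intro interior_param_tight[of c1 c2]) auto
    moreover have "\<forall>k. v k \<bullet> edge_point j i c \<le> 1"
      using c I by (auto simp: edge_params_def set_eq_iff)
    ultimately show False using assms distinct unfolding adjacent_iff_supported by auto
  qed
  then show ?thesis using I by (simp add: edge_slice_eq)
qed

end

section \<open>Entries of the Lovasz matrix\<close>

lemma lovasz_offdiag_eq_mixed_derivative:
  "lovasz_offdiag Q v j i = - mixed_derivative j i one" if "i \<noteq> j"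
proof (cases "skeleton_adj Q v j i")
  case True
  then show ?thesis
    using adjacent_independent lovasz_offdiag_adjacent by (simp add: mixed_derivative_def)
next
  case False
  then show ?thesis
    using edge_slice_nonadjacent[of j i] by (simp add: mixed_derivative_def lovasz_offdiag_def)
qed

lemma skeleton_adj_commute: "skeleton_adj Q v i j \<longleftrightarrow> skeleton_adj Q v j i"
  by (auto simp: skeleton_adj_def closed_segment_commute)

text \<open>Exchanging \<open>i\<close> and \<open>j\<close> reverses the cross product; exchanging
  \<open>f\<close> and \<open>g\<close> compensates with the same \<open>m\<close>.\<close>

lemma lovasz_offdiag_commute: "lovasz_offdiag Q v i j = lovasz_offdiag Q v j i"
proof -
  have "(\<exists>f g. f \<noteq> g \<and> {F \<in> faces2 Q. closed_segment (v i) (v j) \<subseteq> F} = {f, g} \<and>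
           dual_vertex Q v f - dual_vertex Q v g = m *\<^sub>R cross3 (v i) (v j))
     \<longleftrightarrow> (\<exists>f g. f \<noteq> g \<and> {F \<in> faces2 Q. closed_segment (v j) (v i) \<subseteq> F} = {f, g} \<and>
           dual_vertex Q v f - dual_vertex Q v g = m *\<^sub>R cross3 (v j) (v i))" (is "?L i j = ?L j i") for m
  proof -
    have swap: "?L j i" if L: "?L i j" for i j
    proof -
      from L obtain f g where fg: "f \<noteq> g" "{F \<in> faces2 Q. closed_segment (v i) (v j) \<subseteq> F} = {f, g}"
        "dual_vertex Q v f - dual_vertex Q v g = m *\<^sub>R cross3 (v i) (v j)" by blast
      have "dual_vertex Q v g - dual_vertex Q v f = m *\<^sub>R cross3 (v j) (v i)"
        using fg(3) by (simp add: cross_skew[of "v j"] algebra_simps)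
      moreover have "{F \<in> faces2 Q. closed_segment (v j) (v i) \<subseteq> F} = {g, f}"
        using fg(2) unfolding closed_segment_commute[of "v j" "v i"] by (simp add: insert_commute)
      ultimately show ?thesis using fg(1) by blast
    qed
    show ?thesis by (rule iffI; rule swap)
  qed
  then show ?thesis by (simp add: lovasz_offdiag_def skeleton_adj_commute[of i j])
qed

lemma lovasz_diag_eq:
  "has_partial_derivative (facet_area j) j (- lovasz_diag Q v j) one"
proof -
  obtain c where c: "(\<Sum>k\<in>UNIV - {j}. mixed_derivative j k one *\<^sub>R v k) = c *\<^sub>R v j"
    "has_partial_derivative (facet_area j) j (- c) one"
    by (rule facet_area_diagonal)
  have "(\<Sum>k | skeleton_adj Q v j k. lovasz_offdiag Q v j k *\<^sub>R v k)
      = (\<Sum>k\<in>UNIV - {j}. lovasz_offdiag Q v j k *\<^sub>R v k)"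
    \<comment> \<open>Non-adjacent \<open>k\<close> contribute 0, so the sum may run over all
      \<open>k \<noteq> j\<close>, as in \<open>facet_area_diagonal\<close>.\<close>
    by (rule sum.mono_neutral_left) (auto simp: skeleton_adj_def lovasz_offdiag_def)
  also have "\<dots> = (\<Sum>k\<in>UNIV - {j}. - (mixed_derivative j k one *\<^sub>R v k))"
    by (rule sum.cong) (auto simp: lovasz_offdiag_eq_mixed_derivative)
  also have "\<dots> = - (c *\<^sub>R v j)" by (simp add: sum_negf c(1))
  finally have "lovasz_diag Q v j = c"
    unfolding lovasz_diag_def using vertex_nonzero by (intro the_equality) auto
  then show ?thesis using c(2) by simp
qed

text \<open>\<open>facet_area j\<close> serves as the first derivative near \<open>one\<close>. Its
  \<open>i\<close>-derivative is computed for the entry with \<open>j\<close> first, which symmetry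
  identifies with the entry at \<open>i\<close>, \<open>j\<close>.\<close>

lemma second_partial_vol:
  "has_second_partial_derivative vol i j (- lovasz_matrix Q v $ i $ j) one"
proof -
  have "has_partial_derivative (facet_area j) i (- lovasz_matrix Q v $ i $ j) one"
  proof (cases "i = j")
    case True
    then show ?thesis using lovasz_diag_eq by (simp add: lovasz_matrix_def)
  next
    case False
    have "has_partial_derivative (facet_area j) i (mixed_derivative j i one) one"
      using partial_facet_area(1)[OF False] by (rule eventually_nhds_x_imp_x)
    then show ?thesis
      using False lovasz_offdiag_eq_mixed_derivative[OF False]
      by (simp add: lovasz_matrix_def lovasz_offdiag_commute[of i j])
  qed
  then show ?thesis unfolding has_second_partial_derivative_def using partial_vol by blast
qed

end

theorem lemma2p3:
  fixes Q :: "(real^3) set" and v :: "'n::finite \<Rightarrow> real^3" and i j :: 'n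
  assumes "polytope Q"
    and "aff_dim Q = 3"
    and "0 \<in> interior Q"
    and "bij_betw v UNIV {x. x extreme_point_of Q}"
  shows "\<exists>D. has_second_partial_derivative
               (\<lambda>x :: real^'n. measure lebesgue (constraint_polyhedron v x)) i j D (\<chi> k. 1)
           \<and> lovasz_matrix Q v $ i $ j = - D"
proof -
  interpret vertex_polytope Q v using assms by unfold_locales
  show ?thesis
    using second_partial_vol[of i j] unfolding vol_def[abs_def] by (intro exI conjI) auto
qed

end
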